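(* Let $g_1,\dots,g_m\in\operatorname{Sym}\mathcal F_n$ and $h_1,\dots,h_\ell\in\mathcal F_n$. A real-valued quaternionic pseudo-moment sequence $\mathbf y=(y_w)_{w\in\mathcal W}$ has a positive Borel representing measure supported on $K_{\mathbf g,\mathbf h}$ if and only if $L_{\mathbf y}(f)\ge0$ for every $f\in\operatorname{Sym}\mathcal F_n$ satisfying $f\ge0$ on $K_{\mathbf g,\mathbf h}$. Under these conditions, $$L_{\mathbf y}\left(\mathcal I_n^{\mathbb R}+\mathcal J_{\mathbf h}^{\mathbb R}\right)=0.$$
   Context: $\mathbb H$ is the skew field of quaternions, $\mathcal R(a)$ the real part of $a\in\mathbb H$. Fix $n\ge1$ and letters $q_1,\dots,q_n,\bar q_1,\dots,\bar q_n$. $\mathcal W$ is the set of words (including the empty word $1$) in these letters, where words with the same normal form are identified: any consecutive factor $q_i\bar q_i$ or $\bar q_iq_i$ is written $|q_i|^2$ and moved to the front, so each word is uniquely $\prod_i|q_i|^{2\alpha_i}\tilde w$ with $\tilde w$ containing no such factor. $w^*$ is obtained by reversing $w$ and exchanging $q_i\leftrightarrow\bar q_i$. $\mathcal F_n=\mathbb R\langle\mathbf q,\bar{\mathbf q}\rangle$ is the real $*$-algebra of finite sums $\sum_wp_ww$, $p_w\in\mathbb R$, with $p^*=\sum_wp_ww^*$; $\operatorname{Sym}$ denotes elements with $p=p^*$. $p(\mathbf a,\bar{\mathbf a})$ is the evaluation $q_i\mapsto a_i,\bar q_i\mapsto\bar a_i$ at $\mathbf a\in\mathbb H^n$. Words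 $u,v$ are cyclically equivalent, $u\stackrel{\mathrm{cyc}}{\sim}v$, if $u=w_1w_2$, $v=w_2w_1$ for some words $w_1,w_2$. A real-valued sequence $\mathbf y=(y_w)_{w\in\mathcal W}$ is a quaternionic pseudo-moment sequence if $y_w=y_{w^*}$ for all $w$ and $y_u=y_v$ whenever $u\stackrel{\mathrm{cyc}}{\sim}v$. It defines $L_{\mathbf y}:\mathcal F_n\to\mathbb R$, $L_{\mathbf y}(\sum_wp_ww)=\sum_wp_wy_w$. A positive Borel measure $\mu$ on $\mathbb H^n$ represents $\mathbf y$ if $y_w=\int\mathcal R(w(\mathbf a,\bar{\mathbf a}))\,d\mu(\mathbf a)$ for all $w\in\mathcal W$ (all integrals being finite). $K_{\mathbf g,\mathbf h}=\{\mathbf a\in\mathbb H^n: g_i(\mathbf a,\bar{\mathbf a})\ge0\ (1\le i\le m),\ h_j(\mathbf a,\bar{\mathbf a})=0\ (1\le j\le\ell)\}$. $\mathcal I_n^{\mathbb R}$ is the ideal of all $p\in\mathcal F_n$ vanishing under evaluation at every $\mathbf a\in\mathbb H^n$; $\mathcal J_{\mathbf h}^{\mathbb R}$ is the two-sided $*$-ideal of $\mathcal F_n$ generated by $h_1,\dots,h_\ell$. *)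

theory Defs
  imports "HOL-Analysis.Analysis" "HOL-Library.Poly_Mapping"
begin

section \<open>The skew field of quaternions as a Euclidean space\<close>

datatype quat = Quat (qRe: real) (qIm1: real) (qIm2: real) (qIm3: real)

lemma quat_eq_iff:
  "p = q \<longleftrightarrow> qRe p = qRe q \<and> qIm1 p = qIm1 q \<and> qIm2 p = qIm2 q \<and> qIm3 p = qIm3 q"
  by (cases p; cases q) auto

definition qcnj :: "quat \<Rightarrow> quat" where
  "qcnj q = Quat (qRe q) (- qIm1 q) (- qIm2 q) (- qIm3 q)"

lemma qcnj_sel [simp]:
  "qRe (qcnj q) = qRe q" "qIm1 (qcnj q) = - qIm1 q"
  "qIm2 (qcnj q) = - qIm2 q" "qIm3 (qcnj q) = - qIm3 q"
  by (simp_all add: qcnj_def)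

instantiation quat :: ab_group_add
begin

definition "0 = Quat 0 0 0 0"
definition "p + q = Quat (qRe p + qRe q) (qIm1 p + qIm1 q) (qIm2 p + qIm2 q) (qIm3 p + qIm3 q)"
definition "p - q = Quat (qRe p - qRe q) (qIm1 p - qIm1 q) (qIm2 p - qIm2 q) (qIm3 p - qIm3 q)"
definition "- q = Quat (- qRe q) (- qIm1 q) (- qIm2 q) (- qIm3 q)"

instance
  by standard
    (simp_all add: quat_eq_iff zero_quat_def plus_quat_def minus_quat_def uminus_quat_def)

end

lemma quat_add_sel [simp]:
  "qRe 0 = 0" "qIm1 0 = 0" "qIm2 0 = 0" "qIm3 0 = 0"
  "qRe (p + q) = qRe p + qRe q" "qIm1 (p + q) = qIm1 p + qIm1 q"
  "qIm2 (p + q) = qIm2 p + qIm2 q" "qIm3 (p + q) = qIm3 p + qIm3 q"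
  "qRe (p - q) = qRe p - qRe q" "qIm1 (p - q) = qIm1 p - qIm1 q"
  "qIm2 (p - q) = qIm2 p - qIm2 q" "qIm3 (p - q) = qIm3 p - qIm3 q"
  "qRe (- q) = - qRe q" "qIm1 (- q) = - qIm1 q"
  "qIm2 (- q) = - qIm2 q" "qIm3 (- q) = - qIm3 q"
  by (simp_all add: zero_quat_def plus_quat_def minus_quat_def uminus_quat_def)

instantiation quat :: real_algebra_1
begin

definition "1 = Quat 1 0 0 0"
definition "r *\<^sub>R q = Quat (r * qRe q) (r * qIm1 q) (r * qIm2 q) (r * qIm3 q)"
definition "p * q = Quat
  (qRe p * qRe q - qIm1 p * qIm1 q - qIm2 p * qIm2 q - qIm3 p * qIm3 q)
  (qRe p * qIm1 q + qIm1 p * qRe q + qIm2 p * qIm3 q - qIm3 p * qIm2 q)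
  (qRe p * qIm2 q - qIm1 p * qIm3 q + qIm2 p * qRe q + qIm3 p * qIm1 q)
  (qRe p * qIm3 q + qIm1 p * qIm2 q - qIm2 p * qIm1 q + qIm3 p * qRe q)"

instance
  by standard
    (simp_all add: quat_eq_iff one_quat_def scaleR_quat_def times_quat_def algebra_simps)

end

lemma quat_mult_sel [simp]:
  "qRe 1 = 1" "qIm1 1 = 0" "qIm2 1 = 0" "qIm3 1 = 0"
  "qRe (r *\<^sub>R q) = r * qRe q" "qIm1 (r *\<^sub>R q) = r * qIm1 q"
  "qIm2 (r *\<^sub>R q) = r * qIm2 q" "qIm3 (r *\<^sub>R q) = r * qIm3 q"
  "qRe (p * q) = qRe p * qRe q - qIm1 p * qIm1 q - qIm2 p * qIm2 q - qIm3 p * qIm3 q"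
  "qIm1 (p * q) = qRe p * qIm1 q + qIm1 p * qRe q + qIm2 p * qIm3 q - qIm3 p * qIm2 q"
  "qIm2 (p * q) = qRe p * qIm2 q - qIm1 p * qIm3 q + qIm2 p * qRe q + qIm3 p * qIm1 q"
  "qIm3 (p * q) = qRe p * qIm3 q + qIm1 p * qIm2 q - qIm2 p * qIm1 q + qIm3 p * qRe q"
  by (simp_all add: one_quat_def scaleR_quat_def times_quat_def)

instantiation quat :: real_inner
begin

definition "inner p q = qRe p * qRe q + qIm1 p * qIm1 q + qIm2 p * qIm2 q + qIm3 p * qIm3 q"
definition "norm (q :: quat) = sqrt (inner q q)"
definition "sgn (q :: quat) = q /\<^sub>R norm q"
definition "dist (p :: quat) q = norm (p - q)"
definition [code del]: "(uniformity :: (quat \<times> quat) filter) = (INF e\<in>{0<..}. principal {(p, q). dist p q < e})"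
definition [code del]: "open (U :: quat set) \<longleftrightarrow>
  (\<forall>p\<in>U. \<forall>\<^sub>F (p', q) in uniformity. p' = p \<longrightarrow> q \<in> U)"

instance
proof
  fix p q s :: quat and r :: real
  show "inner p q = inner q p"
    by (simp add: inner_quat_def algebra_simps)
  show "inner (p + q) s = inner p s + inner q s"
    by (simp add: inner_quat_def algebra_simps)
  show "inner (r *\<^sub>R p) q = r * inner p q"
    by (simp add: inner_quat_def algebra_simps)
  show "0 \<le> inner p p"
    by (simp add: inner_quat_def)
  show "inner p p = 0 \<longleftrightarrow> p = 0"
    by (simp add: inner_quat_def quat_eq_iff add_nonneg_eq_0_iff)
qed (simp_all add: norm_quat_def sgn_quat_def dist_quat_def uniformity_quat_def open_quat_def)

end

lemma norm_quat_squared: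
  "(norm q)\<^sup>2 = (qRe q)\<^sup>2 + (qIm1 q)\<^sup>2 + (qIm2 q)\<^sup>2 + (qIm3 q)\<^sup>2"
  by (simp add: norm_quat_def inner_quat_def power2_eq_square)

lemma quat_mult_qcnj: "q * qcnj q = (norm q)\<^sup>2 *\<^sub>R 1" "qcnj q * q = (norm q)\<^sup>2 *\<^sub>R 1"
  by (simp_all add: quat_eq_iff norm_quat_squared) (simp_all add: power2_eq_square)

instantiation quat :: real_normed_div_algebra
begin

definition "inverse q = qcnj q /\<^sub>R (norm q)\<^sup>2"
definition "divide p (q :: quat) = p * inverse q"

instance
proof
  fix p q :: quat
  show "p \<noteq> 0 \<Longrightarrow> inverse p * p = 1"
    by (simp add: inverse_quat_def quat_mult_qcnj)
  show "p \<noteq> 0 \<Longrightarrow> p * inverse p = 1"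
    by (simp add: inverse_quat_def quat_mult_qcnj)
  show "p div q = p * inverse q"
    by (rule divide_quat_def)
  show "inverse (0::quat) = 0"
    by (simp add: inverse_quat_def)
  have "(norm (p * q))\<^sup>2 = (norm p * norm q)\<^sup>2"
    unfolding power_mult_distrib norm_quat_squared quat_mult_sel
    by (simp add: power2_eq_square algebra_simps)
  then show "norm (p * q) = norm p * norm q"
    by (simp add: power2_eq_iff_nonneg)
qed

end

instantiation quat :: euclidean_space
begin

definition "Basis = {Quat 1 0 0 0, Quat 0 1 0 0, Quat 0 0 1 0, Quat 0 0 0 1}"

instance
proof
  show "Basis \<noteq> ({} :: quat set)" "finite (Basis :: quat set)"
    by (simp_all add: Basis_quat_def)
next
  fix u v :: quat
  assume "u \<in> Basis" "v \<in> Basis"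
  then show "inner u v = (if u = v then 1 else 0)"
    unfolding Basis_quat_def by (elim insertE emptyE) (simp_all add: inner_quat_def)
next
  fix x :: quat
  show "(\<forall>u\<in>Basis. inner x u = 0) \<longleftrightarrow> x = 0"
    by (simp add: Basis_quat_def inner_quat_def quat_eq_iff[of x])
qed

end

definition qnonneg :: "quat \<Rightarrow> bool" where
  "qnonneg q \<longleftrightarrow> q \<in> \<real> \<and> 0 \<le> qRe q"


section \<open>Words\<close>

datatype 'n letter = Q 'n | Qbar 'n

fun lvar :: "'n letter \<Rightarrow> 'n" where
  "lvar (Q i) = i"
| "lvar (Qbar i) = i"

fun lstar :: "'n letter \<Rightarrow> 'n letter" where
  "lstar (Q i) = Qbar i"
| "lstar (Qbar i) = Q i"

lemma lstar_simps [simp]: "lstar (lstar x) = x" "lvar (lstar x) = lvar x" "lstar x \<noteq> x"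
  by (cases x; simp)+

lemma lstar_inject [simp]: "lstar x = lstar y \<longleftrightarrow> x = y"
  by (metis lstar_simps(1))

text \<open>A pair \<open>(\<alpha>, w)\<close> stands for the normal form with the factors \<open>|q\<^sub>i|\<close> to the power
  \<open>2 * \<alpha> i\<close> in front of the word \<open>w\<close>, which contains no consecutive factor of the form
  \<open>x, lstar x\<close>. A letter put in front of such a word \<open>w\<close> can only create a factor of that form
  at the first position.\<close>

fun nf_push :: "'n letter \<Rightarrow> ('n \<Rightarrow> nat) \<times> 'n letter list \<Rightarrow> ('n \<Rightarrow> nat) \<times> 'n letter list" where
  "nf_push x (\<alpha>, []) = (\<alpha>, [x])"
| "nf_push x (\<alpha>, y # w) =
     (if y = lstar x then (\<alpha>(lvar x := Suc (\<alpha> (lvar x))), w) else (\<alpha>, x # y # w))"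

definition nf :: "'n letter list \<Rightarrow> ('n \<Rightarrow> nat) \<times> 'n letter list" where
  "nf u = foldr nf_push u (\<lambda>_. 0, [])"

lemma nf_Nil [simp]: "nf [] = (\<lambda>_. 0, [])"
  and nf_Cons: "nf (x # u) = nf_push x (nf u)"
  and nf_append: "nf (u @ v) = foldr nf_push u (nf v)"
  by (simp_all add: nf_def)

fun reduced :: "'n letter list \<Rightarrow> bool" where
  "reduced (x # y # w) \<longleftrightarrow> y \<noteq> lstar x \<and> reduced (y # w)"
| "reduced _ \<longleftrightarrow> True"

lemma reduced_ConsD: "reduced (x # w) \<Longrightarrow> reduced w"
  by (cases w) auto

lemma reduced_nf_push: "reduced (snd s) \<Longrightarrow> reduced (snd (nf_push x s))"
  by (induction x s rule: nf_push.induct) (auto dest: reduced_ConsD)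

lemma reduced_foldr_nf_push: "reduced (snd s) \<Longrightarrow> reduced (snd (foldr nf_push u s))"
  by (induction u) (auto intro: reduced_nf_push)

lemma reduced_nf: "reduced (snd (nf u))"
  unfolding nf_def by (rule reduced_foldr_nf_push) simp

definition nf_shift :: "('n \<Rightarrow> nat) \<Rightarrow> ('n \<Rightarrow> nat) \<times> 'n letter list \<Rightarrow> ('n \<Rightarrow> nat) \<times> 'n letter list" where
  "nf_shift \<alpha> s = (\<lambda>i. \<alpha> i + fst s i, snd s)"

lemma nf_shift_push: "nf_push x (nf_shift \<alpha> s) = nf_shift \<alpha> (nf_push x s)"
  by (induction x s rule: nf_push.induct) (auto simp: nf_shift_def fun_eq_iff)

lemma nf_shift_foldr: "foldr nf_push u (nf_shift \<alpha> s) = nf_shift \<alpha> (foldr nf_push u s)"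
  by (induction u) (auto simp: nf_shift_push)

lemma nf_push_lstar:
  assumes "reduced (snd s)"
  shows "nf_push x (nf_push (lstar x) s) = nf_shift ((\<lambda>_. 0)(lvar x := 1)) s"
proof (cases s)
  case (Pair \<alpha> w)
  with assms show ?thesis
    by (cases w rule: reduced.cases) (auto simp: nf_shift_def fun_eq_iff)
qed

lemma foldr_nf_push_nf:
  assumes "reduced (snd s)"
  shows "foldr nf_push u s = nf_shift (fst (nf u)) (foldr nf_push (snd (nf u)) s)"
proof (induction u)
  case Nil
  then show ?case by (simp add: nf_shift_def)
next
  case (Cons x u)
  obtain \<alpha> w where aw: "nf u = (\<alpha>, w)"
    by (cases "nf u")
  have IH: "foldr nf_push (x # u) s = nf_shift \<alpha> (nf_push x (foldr nf_push w s))"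
    using Cons aw by (simp add: nf_shift_push)
  show ?case
  proof (cases "\<exists>w'. w = lstar x # w'")
    case True
    then obtain w' where w': "w = lstar x # w'" by blast
    have "reduced (snd (foldr nf_push w' s))"
      using assms by (rule reduced_foldr_nf_push)
    then have "nf_push x (foldr nf_push w s)
        = nf_shift ((\<lambda>_. 0)(lvar x := 1)) (foldr nf_push w' s)"
      by (simp add: w' nf_push_lstar)
    then show ?thesis
      using w' by (simp add: IH[simplified] nf_Cons aw) (auto simp: nf_shift_def fun_eq_iff)
  next
    case False
    then have "nf_push x (\<alpha>, w) = (\<alpha>, x # w)"
      by (cases w) auto
    then show ?thesis
      by (simp add: IH[simplified] nf_Cons aw)
  qed
qed

lemma nf_append_cong:
  assumes "nf u = nf u'" "nf v = nf v'"
  shows "nf (u @ v) = nf (u' @ v')"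
  using assms foldr_nf_push_nf[OF reduced_nf, of u v] foldr_nf_push_nf[OF reduced_nf, of u' v]
  by (simp add: nf_append)

definition lsstar :: "'n letter list \<Rightarrow> 'n letter list" where
  "lsstar u = rev (map lstar u)"

lemma nf_lsstar: "nf (lsstar u) = nf_shift (fst (nf u)) (nf (lsstar (snd (nf u))))"
proof (induction u)
  case Nil
  then show ?case by (simp add: nf_shift_def lsstar_def)
next
  case (Cons x u)
  obtain \<alpha> w where aw: "nf u = (\<alpha>, w)"
    by (cases "nf u")
  have "nf (lsstar (x # u)) = foldr nf_push (lsstar u) (nf [lstar x])"
    by (simp add: lsstar_def nf_append)
  also have "\<dots> = nf_shift (fst (nf (lsstar u)))
      (foldr nf_push (snd (nf (lsstar u))) (nf [lstar x]))"
    by (rule foldr_nf_push_nf) (rule reduced_nf)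
  also have "\<dots> = nf_shift \<alpha> (nf_shift (fst (nf (lsstar w)))
      (foldr nf_push (snd (nf (lsstar w))) (nf [lstar x])))"
    using Cons aw by (simp add: nf_shift_def add.assoc)
  also have "\<dots> = nf_shift \<alpha> (nf (lsstar w @ [lstar x]))"
    using foldr_nf_push_nf[OF reduced_nf, of "lsstar w" "[lstar x]"] by (simp add: nf_append)
  finally have *: "nf (lsstar (x # u)) = nf_shift \<alpha> (nf (lsstar w @ [lstar x]))" .
  show ?case
  proof (cases "\<exists>w'. w = lstar x # w'")
    case True
    then obtain w' where w': "w = lstar x # w'" by blast
    have "nf [x, lstar x] = nf_shift ((\<lambda>_. 0)(lvar x := 1)) (nf [])"
      by (simp add: nf_Cons nf_shift_def fun_eq_iff)
    then have "nf (lsstar w @ [lstar x]) = nf_shift ((\<lambda>_. 0)(lvar x := 1)) (nf (lsstar w'))"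
      by (simp add: w' lsstar_def nf_append[of "rev _"] nf_shift_foldr del: nf_Nil)
        (simp add: nf_def)
    then show ?thesis
      unfolding * using w' by (auto simp: nf_Cons aw nf_shift_def fun_eq_iff)
  next
    case False
    then have "nf_push x (\<alpha>, w) = (\<alpha>, x # w)"
      by (cases w) auto
    then show ?thesis
      unfolding * by (simp add: nf_Cons aw lsstar_def)
  qed
qed

definition letter_eval :: "quat ^ 'n \<Rightarrow> 'n letter \<Rightarrow> quat" where
  "letter_eval a x = (case x of Q i \<Rightarrow> a $ i | Qbar i \<Rightarrow> qcnj (a $ i))"

definition letters_eval :: "quat ^ 'n \<Rightarrow> 'n letter list \<Rightarrow> quat" where
  "letters_eval a u = prod_list (map (letter_eval a) u)"

lemma letter_eval_lstar: "letter_eval a x * letter_eval a (lstar x) = (norm (a $ lvar x))\<^sup>2 *\<^sub>R 1"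
  by (cases x) (simp_all add: letter_eval_def quat_mult_qcnj)

lemma letters_eval_nf:
  fixes a :: "quat ^ 'n::finite"
  shows "letters_eval a u
    = (\<Prod>i\<in>UNIV. (norm (a $ i)) ^ (2 * fst (nf u) i)) *\<^sub>R letters_eval a (snd (nf u))"
proof (induction u)
  case Nil
  then show ?case by (simp add: letters_eval_def)
next
  case (Cons x u)
  obtain \<alpha> w where aw: "nf u = (\<alpha>, w)"
    by (cases "nf u")
  show ?case
  proof (cases "\<exists>w'. w = lstar x # w'")
    case True
    then obtain w' where w': "w = lstar x # w'" by blast
    have "letters_eval a (x # u) = letter_eval a x *
        ((\<Prod>i\<in>UNIV. (norm (a $ i)) ^ (2 * \<alpha> i)) *\<^sub>R (letter_eval a (lstar x) * letters_eval a w'))"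
      using Cons aw w' by (simp add: letters_eval_def)
    also have "\<dots> = (\<Prod>i\<in>UNIV. (norm (a $ i)) ^ (2 * \<alpha> i)) *\<^sub>R
        ((letter_eval a x * letter_eval a (lstar x)) * letters_eval a w')"
      by (simp add: mult.assoc)
    also have "\<dots> = ((\<Prod>i\<in>UNIV. (norm (a $ i)) ^ (2 * \<alpha> i)) * (norm (a $ lvar x))\<^sup>2) *\<^sub>R
        letters_eval a w'"
      by (simp add: letter_eval_lstar)
    also have "(\<Prod>i\<in>UNIV. (norm (a $ i)) ^ (2 * \<alpha> i)) * (norm (a $ lvar x))\<^sup>2
        = (\<Prod>i\<in>UNIV. (norm (a $ i)) ^ (2 * (\<alpha>(lvar x := Suc (\<alpha> (lvar x)))) i))"
    proof -
      let ?b = "\<lambda>i. norm (a $ i)" and ?\<beta> = "\<alpha>(lvar x := Suc (\<alpha> (lvar x)))"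
      have "(\<Prod>i\<in>UNIV - {lvar x}. ?b i ^ (2 * ?\<beta> i)) = (\<Prod>i\<in>UNIV - {lvar x}. ?b i ^ (2 * \<alpha> i))"
        by (rule prod.cong) auto
      moreover have "(\<Prod>i\<in>UNIV. ?b i ^ (2 * \<alpha> i))
          = ?b (lvar x) ^ (2 * \<alpha> (lvar x)) * (\<Prod>i\<in>UNIV - {lvar x}. ?b i ^ (2 * \<alpha> i))"
        by (rule prod.remove) auto
      moreover have "(\<Prod>i\<in>UNIV. ?b i ^ (2 * ?\<beta> i))
          = ?b (lvar x) ^ (2 * ?\<beta> (lvar x)) * (\<Prod>i\<in>UNIV - {lvar x}. ?b i ^ (2 * ?\<beta> i))"
        by (rule prod.remove) auto
      ultimately show ?thesis
        by (simp only: fun_upd_same mult_Suc_right power_add ac_simps)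
    qed
    finally show ?thesis
      by (simp add: nf_Cons aw w')
  next
    case False
    then have "nf_push x (\<alpha>, w) = (\<alpha>, x # w)"
      by (cases w) auto
    with Cons aw show ?thesis
      by (simp add: nf_Cons letters_eval_def)
  qed
qed

quotient_type 'n word = "'n letter list" / "\<lambda>u v. nf u = nf v"
  by (auto intro!: equivpI reflpI sympI transpI)

text \<open>Concatenation is written additively and the empty word is \<open>0\<close>, because
  \<^typ>\<open>'a \<Rightarrow>\<^sub>0 'b\<close> carries the convolution product for an additive monoid of
  exponents. The addition of words is not commutative.\<close>

instantiation word :: (type) monoid_add
begin

lift_definition zero_word :: "'a word" is "[]" .

lift_definition plus_word :: "'a word \<Rightarrow> 'a word \<Rightarrow> 'a word" is "(@)"
  by (rule nf_append_cong)

instance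
  by standard (transfer, simp)+

end

lift_definition wstar :: "'n word \<Rightarrow> 'n word" is "\<lambda>u. rev (map lstar u)"
  by (metis nf_lsstar lsstar_def)

lift_definition weval :: "'n::finite word \<Rightarrow> quat ^ 'n \<Rightarrow> quat" is
  "\<lambda>u a. prod_list (map (letter_eval a) u)"
  by (rule ext) (metis letters_eval_nf letters_eval_def)

definition cyc_equiv :: "'n word \<Rightarrow> 'n word \<Rightarrow> bool" where
  "cyc_equiv u v \<longleftrightarrow> (\<exists>w1 w2. u = w1 + w2 \<and> v = w2 + w1)"


section \<open>The algebra of quaternionic polynomials\<close>

type_synonym 'n qpoly = "'n word \<Rightarrow>\<^sub>0 real"

definition pstar :: "'n qpoly \<Rightarrow> 'n qpoly" where
  "pstar p = (\<Sum>w\<in>Poly_Mapping.keys p. Poly_Mapping.single (wstar w) (Poly_Mapping.lookup p w))"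

definition Sym :: "'n qpoly set" where
  "Sym = {p. pstar p = p}"

definition peval :: "'n::finite qpoly \<Rightarrow> quat ^ 'n \<Rightarrow> quat" where
  "peval p a = (\<Sum>w\<in>Poly_Mapping.keys p. Poly_Mapping.lookup p w *\<^sub>R weval w a)"

definition K_set ::
  "nat \<Rightarrow> (nat \<Rightarrow> 'n::finite qpoly) \<Rightarrow> nat \<Rightarrow> (nat \<Rightarrow> 'n qpoly) \<Rightarrow> (quat ^ 'n) set" where
  "K_set m g l h =
    {a. (\<forall>i\<in>{1..m}. qnonneg (peval (g i) a)) \<and> (\<forall>j\<in>{1..l}. peval (h j) a = 0)}"

definition vanishing_ideal :: "'n::finite qpoly set" where
  "vanishing_ideal = {p. \<forall>a. peval p a = 0}"

text \<open>Closure under scalars follows from closure under products, since \<^typ>\<open>'n qpoly\<close> has a unit.\<close>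

inductive_set star_ideal :: "'n qpoly set \<Rightarrow> 'n qpoly set" for H :: "'n qpoly set" where
  zero: "0 \<in> star_ideal H"
| gen: "p \<in> H \<Longrightarrow> p \<in> star_ideal H"
| add: "p \<in> star_ideal H \<Longrightarrow> q \<in> star_ideal H \<Longrightarrow> p + q \<in> star_ideal H"
| left: "p \<in> star_ideal H \<Longrightarrow> r * p \<in> star_ideal H"
| right: "p \<in> star_ideal H \<Longrightarrow> p * r \<in> star_ideal H"
| star: "p \<in> star_ideal H \<Longrightarrow> pstar p \<in> star_ideal H"


section \<open>Pseudo-moment sequences and representing measures\<close>

definition pseudo_moment :: "('n word \<Rightarrow> real) \<Rightarrow> bool" where
  "pseudo_moment y \<longleftrightarrow> (\<forall>w. y w = y (wstar w)) \<and> (\<forall>u v. cyc_equiv u v \<longrightarrow> y u = y v)"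

definition riesz :: "('n word \<Rightarrow> real) \<Rightarrow> 'n qpoly \<Rightarrow> real" where
  "riesz y p = (\<Sum>w\<in>Poly_Mapping.keys p. Poly_Mapping.lookup p w * y w)"

definition represents :: "(quat ^ 'n::finite) measure \<Rightarrow> ('n word \<Rightarrow> real) \<Rightarrow> bool" where
  "represents \<mu> y \<longleftrightarrow> sets \<mu> = sets borel \<and>
    (\<forall>w. integrable \<mu> (\<lambda>a. qRe (weval w a)) \<and> y w = (\<integral>a. qRe (weval w a) \<partial>\<mu>))"

text \<open>For a closed set, such as \<^const>\<open>K_set\<close>, this says that it contains the topological
  support of \<open>\<mu>\<close>.\<close>

definition supported_on :: "(quat ^ 'n::finite) measure \<Rightarrow> (quat ^ 'n) set \<Rightarrow> bool" where
  "supported_on \<mu> K \<longleftrightarrow> (AE a in \<mu>. a \<in> K)"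

end

theory Submission
  imports Defs "HOL-Library.Function_Algebras"
begin

text \<open>Since \<open>y\<close> is invariant under the involution, positivity makes \<open>L\<^sub>y(p)\<close> depend only on the
  real function \<open>a \<mapsto> Re p(a)\<close>, so the theorem is an instance of Haviland's theorem for the space of
  these functions, in which \<open>1 + norm a\<close> times any element is dominated by another element.

  Following Marshall, \<open>L\<close> is first extended, by Hahn-Banach, to a positive functional \<open>\<Lambda>\<close> on all
  functions dominated by the space. To represent \<open>\<Lambda>\<close> on functions with compact support, the space is
  embedded into a ball, which is covered by a continuous map \<open>\<theta>\<close> on \<open>\<real>\<close> with a bounded (not necessarily
  measurable) right inverse \<open>\<phi>\<close> on the ball. As \<open>\<Lambda>\<close> is defined on discontinuous functions too,
  \<open>t \<mapsto> \<Lambda>(1[\<phi> \<le> t])\<close> is a distribution function; its Stieltjes measure, pushed forward along \<open>\<theta>\<close>,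
  is the representing measure. Truncation then passes from compact support to the whole space.\<close>

section \<open>Sublinear functionals\<close>

text \<open>With the pointwise addition of \<open>Function_Algebras\<close>, all real functions,
  discontinuous ones included, form one vector space to which \<open>linear\<close> and
  \<open>subspace\<close> apply.\<close>

instantiation "fun" :: (type, real_vector) real_vector
begin

definition "c *\<^sub>R f = (\<lambda>x. c *\<^sub>R f x)"

instance
  by standard (simp_all add: scaleR_fun_def fun_eq_iff scaleR_add_right scaleR_add_left)

end

lemma scaleR_fun_apply [simp]: "(c *\<^sub>R f) x = c *\<^sub>R f x"
  by (simp add: scaleR_fun_def)

definition sublinear :: "('v::real_vector \<Rightarrow> real) \<Rightarrow> bool" where
  "sublinear q \<longleftrightarrow> (\<forall>x y. q (x + y) \<le> q x + q y) \<and> (\<forall>c x. 0 < c \<longrightarrow> q (c *\<^sub>R x) = c * q x)"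

lemma sublinearD:
  assumes "sublinear q"
  shows "q (x + y) \<le> q x + q y" "0 < c \<Longrightarrow> q (c *\<^sub>R x) = c * q x" "q 0 = 0" "- q (- x) \<le> q x"
proof -
  show add: "q (x + y) \<le> q x + q y" for x y
    using assms by (simp add: sublinear_def)
  show "0 < c \<Longrightarrow> q (c *\<^sub>R x) = c * q x"
    using assms by (simp add: sublinear_def)
  have "q (2 *\<^sub>R 0) = 2 * q 0"
    using assms by (simp add: sublinear_def del: scaleR_zero_right)
  then show "q 0 = 0" by simp
  with add[of x "- x"] show "- q (- x) \<le> q x" by simp
qed

text \<open>Of two members of the chain the smaller lies below both, so its subadditivity bounds the
  infimum at \<open>x + y\<close> by \<open>q x + r y\<close> even for different \<open>q\<close>
  and \<open>r\<close>. The bound \<open>b\<close> keeps the real infima meaningful.\<close>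

lemma sublinear_Inf:
  assumes ne: "C \<noteq> {}" and sub: "\<And>q. q \<in> C \<Longrightarrow> sublinear q"
    and bdd: "\<And>q x. q \<in> C \<Longrightarrow> b x \<le> q x"
    and chain: "\<And>q r. q \<in> C \<Longrightarrow> r \<in> C \<Longrightarrow> q \<le> r \<or> r \<le> q"
  shows "sublinear (\<lambda>x. INF q\<in>C. q x)"
proof -
  have bdd': "bdd_below ((\<lambda>q. q x) ` C)" for x
    using bdd by (intro bdd_belowI[of _ "b x"]) auto
  have le: "(INF q\<in>C. q x) \<le> q x" if "q \<in> C" for q x
    using that bdd' by (rule cINF_lower[rotated])
  show ?thesis
    unfolding sublinear_def
  proof (intro conjI allI impI)
    fix x y
    have "(INF q\<in>C. q (x + y)) \<le> q x + r y" if "q \<in> C" "r \<in> C" for q r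
      using chain[OF that] le[OF that(1), of "x + y"] le[OF that(2), of "x + y"]
        sublinearD(1)[OF sub[OF that(1)], of x y] sublinearD(1)[OF sub[OF that(2)], of x y]
      by (force simp: le_fun_def dest: spec[where x=x] spec[where x=y])
    then have "(INF q\<in>C. q (x + y)) - r y \<le> (INF q\<in>C. q x)" if "r \<in> C" for r
      using that ne by (intro cINF_greatest) (auto simp: algebra_simps)
    then have "(INF q\<in>C. q (x + y)) - (INF q\<in>C. q x) \<le> (INF q\<in>C. q y)"
      using ne by (intro cINF_greatest) (auto simp: algebra_simps)
    then show "(INF q\<in>C. q (x + y)) \<le> (INF q\<in>C. q x) + (INF q\<in>C. q y)" by simp
  next
    fix c :: real and x
    assume c: "0 < c"
    show "(INF q\<in>C. q (c *\<^sub>R x)) = c * (INF q\<in>C. q x)"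
    proof (rule antisym)
      have "(INF q\<in>C. q (c *\<^sub>R x)) / c \<le> (INF q\<in>C. q x)"
        using le[of _ "c *\<^sub>R x"] sublinearD(2)[OF sub c] ne c
        by (intro cINF_greatest) (auto simp: field_simps)
      then show "(INF q\<in>C. q (c *\<^sub>R x)) \<le> c * (INF q\<in>C. q x)"
        using c by (simp add: field_simps)
      show "c * (INF q\<in>C. q x) \<le> (INF q\<in>C. q (c *\<^sub>R x))"
        using mult_left_mono[OF le[of _ x], of _ c] sublinearD(2)[OF sub c] ne c
        by (intro cINF_greatest) auto
    qed
  qed
qed

text \<open>Sliding along the ray of \<open>v\<close> and subtracting the known value pushes
  \<open>q\<close> down: t = 0 gives \<open>r \<le> q\<close>, and t = 1 at \<open>- v\<close> gives
  the last bound. The purpose is to show that a minimal sublinear functional is odd.\<close>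

lemma sublinear_slide:
  fixes v :: "'v::real_vector"
  assumes q: "sublinear q"
  obtains r where "sublinear r" "r \<le> q" "r (- v) \<le> - q v"
proof -
  define r where "r x = (INF t\<in>{0..}. q (x + t *\<^sub>R v) - t * q v)" for x
  note sl = sublinearD[OF q]
  have qt: "q (t *\<^sub>R v) = t * q v" if "0 \<le> t" for t
    using that sl(2)[of t v] sl(3) by (cases "t = 0") auto
  \<comment> \<open>Writing t v as (x + t v) + (- x), subadditivity gives a lower bound independent
    of t, so the infimum is finite.\<close>
  have lb: "- q (- x) \<le> q (x + t *\<^sub>R v) - t * q v" if "0 \<le> t" for x t
    using sl(1)[of "x + t *\<^sub>R v" "- x"] qt[OF that] by simp
  have bdd: "bdd_below ((\<lambda>t. q (x + t *\<^sub>R v) - t * q v) ` {0..})" for x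
    using lb by (intro bdd_belowI[of _ "- q (- x)"]) auto
  have le: "r x \<le> q (x + t *\<^sub>R v) - t * q v" if "0 \<le> t" for x t
    unfolding r_def using that by (intro cINF_lower bdd) auto
  have ge: "c \<le> r x" if "\<And>t. 0 \<le> t \<Longrightarrow> c \<le> q (x + t *\<^sub>R v) - t * q v" for c x
    unfolding r_def using that by (intro cINF_greatest) auto
  have "r \<le> q"
    using le[of 0] by (simp add: le_fun_def)
  moreover have "r (- v) \<le> - q v"
    using le[of 1 "- v"] sl(3) by simp
  moreover have "sublinear r"
    unfolding sublinear_def
  proof (intro conjI allI impI)
    fix x y
    have *: "r (x + y) \<le> (q (x + s *\<^sub>R v) - s * q v) + (q (y + t *\<^sub>R v) - t * q v)"
      if "0 \<le> s" "0 \<le> t" for s t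
      using le[of "s + t" "x + y"] that sl(1)[of "x + s *\<^sub>R v" "y + t *\<^sub>R v"]
      by (simp add: algebra_simps)
    have "r (x + y) - (q (y + t *\<^sub>R v) - t * q v) \<le> r x" if "0 \<le> t" for t
      using * that by (intro ge) (simp add: algebra_simps)
    then have "r (x + y) - r x \<le> r y"
      by (intro ge) (simp add: algebra_simps)
    then show "r (x + y) \<le> r x + r y" by simp
  next
    have scale: "r (c *\<^sub>R x) \<le> c * r x" if c: "0 < c" for c x
    proof -
      have "r (c *\<^sub>R x) / c \<le> r x"
      proof (rule ge)
        fix t :: real assume "0 \<le> t"
        then have "r (c *\<^sub>R x) \<le> q (c *\<^sub>R (x + t *\<^sub>R v)) - c * t * q v"
          using le[of "c * t" "c *\<^sub>R x"] c by (simp add: algebra_simps)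
        also have "\<dots> = c * (q (x + t *\<^sub>R v) - t * q v)"
          by (simp add: sl(2)[OF c] right_diff_distrib del: scaleR_add_right)
        finally show "r (c *\<^sub>R x) / c \<le> q (x + t *\<^sub>R v) - t * q v"
          using c by (simp add: field_simps)
      qed
      then show ?thesis using c by (simp add: field_simps)
    qed
    fix c :: real and x assume c: "0 < c"
    \<comment> \<open>The reverse inequality is \<open>scale\<close> for the factor 1/c at the point
      \<open>c *\<^sub>R x\<close>.\<close>
    have "r ((1 / c) *\<^sub>R (c *\<^sub>R x)) \<le> (1 / c) * r (c *\<^sub>R x)"
      using c by (intro scale) simp
    with scale[OF c, of x] c show "r (c *\<^sub>R x) = c * r x"
      by (simp add: field_simps)
  qed
  ultimately show thesis using that by blast
qed

text \<open>A minimal sublinear functional is linear.\<close>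

theorem sublinear_dominates_linear:
  fixes p :: "'v::real_vector \<Rightarrow> real"
  assumes p: "sublinear p"
  obtains \<Lambda> where "linear \<Lambda>" "\<Lambda> \<le> p"
proof -
  define S where "S = {q. sublinear q \<and> q \<le> p}"
  \<comment> \<open>The order is reversed, so that Zorn's lemma delivers a minimal sublinear
    functional below \<open>p\<close>.\<close>
  let ?P = "\<lambda>q r :: 'v \<Rightarrow> real. r \<le> q"
  have "\<exists>m\<in>S. \<forall>a\<in>S. ?P m a \<longrightarrow> a = m"
  proof (rule predicate_Zorn)
    show "partial_order_on S (relation_of ?P S)"
      by (intro partial_order_on_relation_ofI) auto
  next
    fix C assume C: "C \<in> Chains (relation_of ?P S)"
    then have CS: "C \<subseteq> S" by (auto simp: Chains_def relation_of_def)
    show "\<exists>u\<in>S. \<forall>a\<in>C. ?P a u"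
    proof (cases "C = {}")
      case True
      with p show ?thesis by (auto simp: S_def)
    next
      case False
      have lb: "- p (- x) \<le> q x" if "q \<in> C" for q x
        using that CS sublinearD(4)[of q x] by (force simp: S_def le_fun_def dest: spec[where x="- x"])
      have bdd: "bdd_below ((\<lambda>q. q x) ` C)" for x
        using lb by (intro bdd_belowI[of _ "- p (- x)"]) auto
      let ?u = "\<lambda>x. INF q\<in>C. q x"
      have le: "?u \<le> q" if "q \<in> C" for q
        using that bdd by (auto simp: le_fun_def intro!: cINF_lower)
      have "sublinear ?u"
        using False CS C lb
        by (intro sublinear_Inf[where b = "\<lambda>x. - p (- x)"]) (auto simp: S_def Chains_def relation_of_def)
      moreover obtain q where "q \<in> C" using False by blast
      with le CS have "?u \<le> p" by (force simp: S_def intro: order_trans)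
      ultimately show ?thesis using le by (auto simp: S_def)
    qed
  qed
  then obtain q where "q \<in> S" and min': "\<And>r. r \<in> S \<Longrightarrow> r \<le> q \<Longrightarrow> r = q"
    by blast
  then have q: "sublinear q" "q \<le> p" by (simp_all add: S_def)
  have min: "r = q" if "sublinear r" "r \<le> q" for r
    using that order_trans[OF that(2) q(2)] by (intro min') (simp_all add: S_def)
  note sl = sublinearD[OF q(1)]
  have neg: "q (- v) = - q v" for v
  proof -
    \<comment> \<open>By minimality \<open>r\<close> is \<open>q\<close> itself, so its bound at
      \<open>- v\<close> holds for \<open>q\<close>; the opposite inequality holds for every
      sublinear functional.\<close>
    obtain r where "sublinear r" "r \<le> q" "r (- v) \<le> - q v"
      using q(1) by (rule sublinear_slide)
    then show ?thesis using min[of r] sl(4)[of "- v"] by simp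
  qed
  \<comment> \<open>Since \<open>q\<close> is odd, subadditivity at the pairs x, y and -x, -y gives
    the two inequalities.\<close>
  have add: "q (x + y) = q x + q y" for x y
    using sl(1)[of x y] sl(1)[of "- x" "- y"] neg[of "x + y"] neg[of x] neg[of y] by simp
  have "q (c *\<^sub>R x) = c * q x" for c x
  proof -
    consider "c > 0" | "c = 0" | "- c > 0" by linarith
    then show ?thesis
    proof cases
      case 3
      then show ?thesis using sl(2)[OF 3, of x] neg[of "c *\<^sub>R x"] by simp
    qed (use sl in auto)
  qed
  with add have "linear q" by (intro linearI) auto
  with q(2) show thesis by (rule that[rotated])
qed

section \<open>Stieltjes measures from positive functionals\<close>

text \<open>\<open>interval_measure\<close> wants a right-continuous function, so \<open>F\<close>
  is replaced by its right limit \<open>G\<close>. The two agree where \<open>F\<close> is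
  continuous, which is why increments are claimed between continuity points. As the intervals are
  open on the left, the margin in \<open>a - 1\<close> leaves room for an atom at
  \<open>a\<close>.\<close>

lemma stieltjes_measure:
  fixes F :: "real \<Rightarrow> real"
  assumes mono: "mono F" and ab: "a \<le> b"
    and left: "\<And>t. t < a \<Longrightarrow> F t = 0" and right: "\<And>t. b \<le> t \<Longrightarrow> F t = c"
  obtains \<rho> where "finite_measure \<rho>" "sets \<rho> = sets borel" "AE t in \<rho>. a - 1 < t \<and> t \<le> b"
    "\<And>s t. s \<le> t \<Longrightarrow> isCont F s \<Longrightarrow> isCont F t \<Longrightarrow> measure \<rho> {s<..t} = F t - F s"
proof -
  define G where "G t = (INF s\<in>{t<..}. F s)" for t
  have F0: "0 \<le> F t" for t
    using monoD[OF mono, of "min t (a - 1)" t] left[of "min t (a - 1)"] by simp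
  have bdd: "bdd_below (F ` {t<..})" for t
    using F0 by (intro bdd_belowI[of _ 0]) auto
  have Gle: "G t \<le> F s" if "t < s" for s t
    unfolding G_def using that by (intro cINF_lower bdd) auto
  have Gge: "d \<le> G t" if "\<And>s. t < s \<Longrightarrow> d \<le> F s" for d t
    unfolding G_def using that by (intro cINF_greatest) auto
  have FG: "F t \<le> G t" for t
    by (rule Gge) (rule monoD[OF mono less_imp_le])
  have Gmono: "G s \<le> G t" if "s \<le> t" for s t
    using that by (intro Gge Gle) auto
  have Gcont: "continuous (at_right t) G" for t
    unfolding continuous_within
  proof (rule order_tendstoI)
    fix d assume "d < G t"
    then show "\<forall>\<^sub>F x in at_right t. d < G x"
      using Gmono by (auto simp: eventually_at_right_field intro!: exI[of _ "t + 1"] elim: less_le_trans)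
  next
    fix d assume "G t < d"
    then obtain s where "t < s" "F s < d"
      unfolding G_def using cINF_less_iff[OF _ bdd] by auto
    then show "\<forall>\<^sub>F x in at_right t. G x < d"
      using Gle[THEN le_less_trans] by (auto simp: eventually_at_right_field intro!: exI[of _ s])
  qed
  have GF: "G t = F t" if "isCont F t" for t
  proof (rule antisym)
    have "(F \<longlongrightarrow> F t) (at_right t)"
      using that by (auto simp: isCont_def intro: tendsto_within_subset)
    then show "G t \<le> F t"
      by (rule tendsto_lowerbound)
        (use Gle in \<open>auto simp: eventually_at_right_field intro!: exI[of _ "t + 1"]\<close>)
  qed (rule FG)
  have G0: "G t = 0" if "t < a" for t
  proof -
    from dense[OF that] obtain s where "t < s" "s < a" by blast
    then have "G t \<le> 0" using Gle[of t s] left[of s] by simp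
    moreover have "0 \<le> G t" using F0 by (rule Gge)
    ultimately show ?thesis by simp
  qed
  have Gc: "G t = c" if "b \<le> t" for t
  proof (rule antisym)
    show "G t \<le> c" using Gle[of t "t + 1"] right[of "t + 1"] that by simp
    show "c \<le> G t" using right that by (intro Gge) auto
  qed
  let ?\<rho> = "interval_measure G"
  have em: "emeasure ?\<rho> {s<..t} = G t - G s" if "s \<le> t" for s t
    using that Gmono Gcont by (rule emeasure_interval_measure_Ioc)
  have c0: "0 \<le> c" using F0[of b] right[of b] by simp
  \<comment> \<open>These intervals exhaust the line and each of them already has mass
    \<open>c\<close>, which is therefore the total mass.\<close>
  have "(\<lambda>n. emeasure ?\<rho> {a - 1 - real n<..b + real n}) \<longlonglongrightarrow> emeasure ?\<rho> (\<Union>n. {a - 1 - real n<..b + real n})"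
    by (rule Lim_emeasure_incseq) (auto simp: incseq_def)
  moreover have "emeasure ?\<rho> {a - 1 - real n<..b + real n} = ennreal c" for n
    using em[of "a - 1 - real n" "b + real n"] ab G0 Gc by simp
  moreover have "(\<Union>n. {a - 1 - real n<..b + real n}) = UNIV"
  proof (rule UNIV_eq_I[symmetric])
    fix x
    obtain n where "\<bar>a\<bar> + \<bar>b\<bar> + 1 + \<bar>x\<bar> < real n" using reals_Archimedean2 by blast
    then have "x \<in> {a - 1 - real n<..b + real n}" by auto
    then show "x \<in> (\<Union>n. {a - 1 - real n<..b + real n})" by blast
  qed
  ultimately have eU: "emeasure ?\<rho> UNIV = ennreal c"
    by (simp add: LIMSEQ_const_iff)
  interpret finite_measure ?\<rho>
    by standard (simp add: eU)
  have "emeasure ?\<rho> (UNIV - {a - 1<..b}) = 0"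
    using em[of "a - 1" b] ab G0 Gc eU c0 by (subst emeasure_Diff) auto
  then have "AE t in ?\<rho>. t \<in> {a - 1<..b}"
    by (intro AE_I[where N = "UNIV - {a - 1<..b}"]) auto
  moreover have "measure ?\<rho> {s<..t} = F t - F s" if "s \<le> t" "isCont F s" "isCont F t" for s t
    using em[OF that(1)] GF that Gmono[OF that(1)] by (simp add: measure_def)
  ultimately show thesis
    by (intro that[of ?\<rho>]) (auto intro: finite_measure_axioms)
qed

lemma sum_fun_apply: "(\<Sum>i\<in>I. f i) x = (\<Sum>i\<in>I. f i x)"
  by (induction I rule: infinite_finite_induct) auto

text \<open>As \<open>L\<close> accepts arbitrary indicator functions, its value at the indicator of
  u \<le> t is a distribution function in t. \<open>L\<close> and the resulting Stieltjes measure
  agree on step functions of \<open>u\<close>, and a continuous \<open>h\<close> is a uniform limit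
  of step functions on a bounded interval.\<close>

lemma riesz_bounded_real_function:
  fixes L :: "('a \<Rightarrow> real) \<Rightarrow> real" and u :: "'a \<Rightarrow> real"
  assumes lin: "linear L"
    and pos: "\<And>f. bounded (range f) \<Longrightarrow> (\<And>x. 0 \<le> f x) \<Longrightarrow> 0 \<le> L f"
    and u: "\<And>x. \<bar>u x\<bar> \<le> c"
  obtains \<rho> where "finite_measure \<rho>" "sets \<rho> = sets borel"
    "\<And>h :: real \<Rightarrow> real. continuous_on UNIV h \<Longrightarrow> bounded (range h) \<Longrightarrow>
      integral\<^sup>L \<rho> h = L (\<lambda>x. h (u x))"
proof -
  have c0: "0 \<le> c" using u[of undefined] by simp
  have monoL: "L f \<le> L g" if "bounded (range f)" "bounded (range g)" "\<And>x. f x \<le> g x" for f g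
    using pos[of "g - f"] that bounded_minus_comp[OF that(2,1)] linear_diff[OF lin, of g f]
    by (simp add: fun_diff_def)
  define \<eta> where "\<eta> t = (\<lambda>x. of_bool (u x \<le> t) :: real)" for t
  have bdd\<eta>: "bounded (range (\<eta> t))" for t
    by (rule boundedI[of _ 1]) (auto simp: \<eta>_def)
  define F where "F t = L (\<eta> t)" for t
  define M where "M = L (\<lambda>_. 1)"
  have M0: "0 \<le> M" unfolding M_def by (rule pos) auto
  have "mono F"
    unfolding F_def by (intro monoI monoL bdd\<eta>) (auto simp: \<eta>_def)
  have F_left: "F t = 0" if "t < - c" for t
  proof -
    have "\<not> u x \<le> t" for x using u[of x] that by linarith
    then have "\<eta> t = 0" by (simp add: \<eta>_def fun_eq_iff)
    then show ?thesis using linear_0[OF lin] by (simp add: F_def)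
  qed
  have F_right: "F t = M" if "c \<le> t" for t
  proof -
    have "u x \<le> t" for x using u[of x] that by linarith
    then have "\<eta> t = (\<lambda>_. 1)" by (simp add: \<eta>_def)
    then show ?thesis by (simp add: F_def M_def)
  qed
  have "- c \<le> c" using c0 by simp
  obtain \<rho> where \<rho>: "finite_measure \<rho>" "sets \<rho> = sets borel"
    and AE: "AE t in \<rho>. - c - 1 < t \<and> t \<le> c"
    and meas: "\<And>s t. s \<le> t \<Longrightarrow> isCont F s \<Longrightarrow> isCont F t \<Longrightarrow> measure \<rho> {s<..t} = F t - F s"
    using \<open>mono F\<close> \<open>- c \<le> c\<close> F_left F_right by (rule stieltjes_measure) (assumption | blast intro: that)+
  interpret finite_measure \<rho> by fact
  define D where "D = {t. \<not> isCont F t}"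
  have "countable D"
    unfolding D_def using \<open>mono F\<close> by (rule mono_ctble_discont)
  \<comment> \<open>Only countably many offsets put some grid point s + i/(N + 1) on a discontinuity
    of \<open>F\<close>, so one \<open>s\<close> serves all N and i at once.\<close>
  then have "countable (\<Union>i::int. \<Union>N::nat. (\<lambda>d. d - i / real (Suc N)) ` D)"
    by (intro countable_UN countable_image) auto
  then obtain s where s: "s \<notin> (\<Union>i::int. \<Union>N::nat. (\<lambda>d. d - i / real (Suc N)) ` D)"
    using uncountable_UNIV_real by (metis UNIV_eq_I)
  define t where "t N i = s + of_int i / real (Suc N)" for N and i :: int
  have cont_t: "isCont F (t N i)" for N i
  proof (rule ccontr)
    assume "\<not> isCont F (t N i)"
    then have "s = t N i - of_int i / real (Suc N)" "t N i \<in> D" by (auto simp: t_def D_def)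
    with s show False by blast
  qed
  \<comment> \<open>\<open>k N x\<close> is the index of the grid cell containing \<open>x\<close>,
    and \<open>r N x\<close> is the right endpoint of that cell. Cells are open on the left and
    closed on the right, matching \<open>\<eta>\<close> and \<open>meas\<close>.\<close>
  define k where "k N x = \<lceil>(x - s) * real (Suc N)\<rceil>" for N x
  define r where "r N x = t N (k N x)" for N x
  have r: "x \<le> r N x" "r N x \<le> x + 1 / real (Suc N)" for N x
  proof -
    let ?m = "real (Suc N)"
    have k: "(x - s) * ?m \<le> k N x" "k N x \<le> (x - s) * ?m + 1"
      unfolding k_def by linarith+
    have "x - s \<le> k N x / ?m"
      using k(1) by (subst pos_le_divide_eq) auto
    then show "x \<le> r N x" by (simp add: r_def t_def)
    have "k N x / ?m \<le> ((x - s) * ?m + 1) / ?m"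
      using k(2) by (rule divide_right_mono) simp
    also have "\<dots> = x - s + 1 / ?m" by (simp add: add_divide_distrib)
    finally show "r N x \<le> x + 1 / ?m" by (simp add: r_def t_def)
  qed
  have cell: "k N x = i \<longleftrightarrow> t N (i - 1) < x \<and> x \<le> t N i" for N x i
  proof -
    let ?m = "real (Suc N)"
    have "k N x = i \<longleftrightarrow> (i - 1) < (x - s) * ?m \<and> (x - s) * ?m \<le> i"
      unfolding k_def by (simp add: ceiling_eq_iff)
    also have "\<dots> \<longleftrightarrow> (i - 1) / ?m < x - s \<and> x - s \<le> i / ?m"
      by (simp only: pos_divide_less_eq pos_le_divide_eq of_nat_0_less_iff zero_less_Suc)
    finally show ?thesis by (auto simp: t_def algebra_simps simp del: of_nat_Suc)
  qed
  have kmono: "k N x \<le> k N y" if "x \<le> y" for N x y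
    unfolding k_def using that by (intro ceiling_mono mult_right_mono) auto
  show thesis
  proof (rule that[of \<rho>])
    fix h :: "real \<Rightarrow> real"
    assume h: "continuous_on UNIV h" "bounded (range h)"
    obtain B where B: "\<And>x. \<bar>h x\<bar> \<le> B"
      using h(2) by (auto simp: bounded_iff)
    have hm: "h \<in> borel_measurable borel" using h(1) by (rule borel_measurable_continuous_onI)
    have hu: "bounded (range (\<lambda>x. h (f x)))" for f :: "'b \<Rightarrow> real"
      using B by (intro boundedI[of _ B]) auto
    have step: "integral\<^sup>L \<rho> (\<lambda>x. h (r N x)) = L (\<lambda>x. h (r N (u x)))" for N
    proof -
      \<comment> \<open>The cells meeting the interval from - c - 1 to c, which contains all values
        of \<open>u\<close> and \<open>\<rho>\<close>-almost every point.\<close>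
      define I where "I = {k N (- c - 1)..k N c}"
      have repr: "h (r N x) = (\<Sum>i\<in>I. h (t N i) * indicator {t N (i - 1)<..t N i} x)"
        if "- c - 1 \<le> x" "x \<le> c" for x
      proof -
        have "indicator {t N (i - 1)<..t N i} x = (if i = k N x then 1 else 0 :: real)" for i
          using cell[of N x i] by (auto simp: indicator_def)
        then have "(\<Sum>i\<in>I. h (t N i) * indicator {t N (i - 1)<..t N i} x) =
            (\<Sum>i\<in>I. if i = k N x then h (t N i) else 0)"
          by (intro sum.cong) simp_all
        also have "\<dots> = h (r N x)"
          using kmono[OF that(1)] kmono[OF that(2)] by (simp add: I_def r_def)
        finally show ?thesis by simp
      qed
      have le: "t N (i - 1) \<le> t N i" for i by (simp add: t_def field_simps)
      have cell_int: "integrable \<rho> (indicat_real {t N (i - 1)<..t N i})" for i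
        using \<rho>(2) by (intro integrable_real_indicator) (auto simp: emeasure_finite less_top[symmetric])
      have "integral\<^sup>L \<rho> (\<lambda>x. h (r N x)) = (\<integral>x. (\<Sum>i\<in>I. h (t N i) * indicator {t N (i - 1)<..t N i} x) \<partial>\<rho>)"
      proof (rule integral_cong_AE)
        show "(\<lambda>x. h (r N x)) \<in> borel_measurable \<rho>"
          unfolding r_def t_def k_def using hm \<rho>(2) by measurable
      qed (use AE repr \<rho>(2) in \<open>auto cong: measurable_cong_sets\<close>)
      also have "\<dots> = (\<Sum>i\<in>I. h (t N i) * measure \<rho> {t N (i - 1)<..t N i})"
        by (simp add: cell_int sets_eq_imp_space_eq[OF \<rho>(2)])
      also have "\<dots> = (\<Sum>i\<in>I. h (t N i) * (F (t N i) - F (t N (i - 1))))"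
        by (simp add: meas[OF le cont_t cont_t])
      \<comment> \<open>By linearity the Stieltjes sum is \<open>L\<close> of a step function,
        because a difference of two neighbouring \<open>\<eta>\<close> is the indicator of
        \<open>u\<close> lying in one cell.\<close>
      also have "\<dots> = L (\<Sum>i\<in>I. h (t N i) *\<^sub>R (\<eta> (t N i) - \<eta> (t N (i - 1))))"
        by (simp add: linear_sum[OF lin] linear_scale[OF lin] linear_diff[OF lin] F_def)
      also have "(\<Sum>i\<in>I. h (t N i) *\<^sub>R (\<eta> (t N i) - \<eta> (t N (i - 1)))) = (\<lambda>x. h (r N (u x)))"
      proof
        fix x
        have "\<eta> (t N i) x - \<eta> (t N (i - 1)) x = indicator {t N (i - 1)<..t N i} (u x)" for i
          using le[of i] by (auto simp: \<eta>_def indicator_def)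
        then show "(\<Sum>i\<in>I. h (t N i) *\<^sub>R (\<eta> (t N i) - \<eta> (t N (i - 1)))) x = h (r N (u x))"
          using repr[of "u x"] u[of x] by (simp add: sum_fun_apply abs_le_iff)
      qed
      finally show ?thesis .
    qed
    have r_lim: "(\<lambda>N. r N x) \<longlonglongrightarrow> x" for x
    proof (rule tendsto_sandwich[OF _ _ tendsto_const])
      show "(\<lambda>N. x + 1 / real (Suc N)) \<longlonglongrightarrow> x"
        using tendsto_add[OF tendsto_const LIMSEQ_inverse_real_of_nat, of x]
        by (simp add: inverse_eq_divide)
    qed (use r in auto)
    have "(\<lambda>N. integral\<^sup>L \<rho> (\<lambda>x. h (r N x))) \<longlonglongrightarrow> integral\<^sup>L \<rho> h"
    proof (rule integral_dominated_convergence[where w = "\<lambda>_. B"])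
      show "(\<lambda>x. h (r N x)) \<in> borel_measurable \<rho>" for N
        unfolding r_def t_def k_def using hm \<rho>(2) by measurable
      have "isCont h x" for x using h(1) by (simp add: continuous_on_eq_continuous_at)
      then show "AE x in \<rho>. (\<lambda>N. h (r N x)) \<longlonglongrightarrow> h x"
        using r_lim isCont_tendsto_compose[of _ h] by (intro AE_I2) blast
    qed (use hm \<rho>(2) B in \<open>auto cong: measurable_cong_sets\<close>)
    moreover have "(\<lambda>N. L (\<lambda>x. h (r N (u x)))) \<longlonglongrightarrow> L (\<lambda>x. h (u x))"
    proof (rule LIMSEQ_I)
      fix e :: real assume e: "0 < e"
      \<comment> \<open>The denominator \<open>M + 1\<close> also covers
        \<open>M = 0\<close>.\<close>
      define e' where "e' = e / (M + 1)"
      have e': "0 < e'" "e' * M < e" using e M0 by (auto simp: e'_def field_simps)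
      \<comment> \<open>Rounding up moves a value of \<open>u\<close> by at most 1, hence the right
        end \<open>c + 1\<close>.\<close>
      have "uniformly_continuous_on {-c..c+1} h"
        using h(1) by (intro compact_uniformly_continuous) (auto intro: continuous_on_subset)
      then obtain d where d: "0 < d"
        and dh: "\<And>x y. x \<in> {-c..c+1} \<Longrightarrow> y \<in> {-c..c+1} \<Longrightarrow> dist y x < d \<Longrightarrow> dist (h y) (h x) < e'"
        using e' unfolding uniformly_continuous_on_def by metis
      obtain N0 where N0: "1 / real (Suc N0) < d"
        using d by (metis inverse_eq_divide reals_Archimedean)
      show "\<exists>N0. \<forall>N\<ge>N0. norm (L (\<lambda>x. h (r N (u x))) - L (\<lambda>x. h (u x))) < e"
      proof (intro exI allI impI)
        fix N assume "N0 \<le> N"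
        then have "1 / real (Suc N) \<le> 1 / real (Suc N0)" by (simp add: field_simps)
        then have lt: "1 / real (Suc N) < d" "1 / real (Suc N) \<le> 1" using N0 by auto
        have close: "\<bar>h (r N (u x)) - h (u x)\<bar> \<le> e'" for x
        proof -
          have "r N (u x) \<le> c + 1" "r N (u x) - u x < d"
            using r(2)[of N "u x"] lt u[of x] by linarith+
          then have "dist (h (r N (u x))) (h (u x)) < e'"
            using u[of x] r(1)[of "u x" N] by (intro dh) (auto simp: dist_real_def abs_le_iff)
          then show ?thesis by (simp add: dist_real_def)
        qed
        have eM: "L (\<lambda>_. e') = e' * M"
          using linear_scale[OF lin, of e' "\<lambda>_. 1"] by (simp add: M_def scaleR_fun_def)
        have diff: "L (\<lambda>x. f x - g x) = L f - L g" for f g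
          using linear_diff[OF lin, of f g] by (simp add: fun_diff_def)
        have "L (\<lambda>x. h (r N (u x)) - h (u x)) \<le> L (\<lambda>_. e')"
          "L (\<lambda>x. h (u x) - h (r N (u x))) \<le> L (\<lambda>_. e')"
          using close by (auto intro!: monoL bounded_minus_comp hu simp: abs_le_iff)
        then show "norm (L (\<lambda>x. h (r N (u x))) - L (\<lambda>x. h (u x))) < e"
          using e' eM by (simp add: diff abs_less_iff)
      qed
    qed
    ultimately show "integral\<^sup>L \<rho> h = L (\<lambda>x. h (u x))"
      by (simp add: step LIMSEQ_unique)
  qed fact+
qed

section \<open>Compact sets as continuous images\<close>

text \<open>The first nonzero digit contributes (1/3)^k, and all later digits together at most half
  of that. In base 2 the tail could cancel it completely.\<close>

lemma abs_ternary_ge: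
  fixes d :: "nat \<Rightarrow> real"
  assumes d: "\<And>j. \<bar>d j\<bar> \<le> 1" and zero: "\<And>j. j < k \<Longrightarrow> d j = 0" and k: "\<bar>d k\<bar> = 1"
  shows "(1/3) ^ k / 2 \<le> \<bar>suminf (\<lambda>j. d j * (1/3) ^ j)\<bar>"
proof -
  have le: "norm (d j * (1/3) ^ j) \<le> (1/3) ^ j" for j
    using d[of j] by (simp add: abs_mult power_abs mult_left_le_one_le)
  have geo: "summable (\<lambda>j. (1/3) ^ j :: real)" by (rule summable_geometric) simp
  have sum: "summable (\<lambda>j. d j * (1/3) ^ j)"
    by (rule summable_comparison_test'[OF geo]) (rule le)
  let ?t = "suminf (\<lambda>n. d (n + Suc k) * (1/3) ^ (n + Suc k))"
  have "(\<Sum>i<Suc k. d i * (1/3) ^ i) = d k * (1/3) ^ k"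
    using zero by simp
  then have split: "suminf (\<lambda>j. d j * (1/3) ^ j) = ?t + d k * (1/3) ^ k"
    using suminf_split_initial_segment[OF sum, of "Suc k"] by simp
  have "\<bar>?t\<bar> \<le> suminf (\<lambda>n. (1/3) ^ (n + Suc k))"
    unfolding real_norm_def[symmetric]
    by (intro norm_suminf_le le summable_ignore_initial_segment geo)
  also have "\<dots> = suminf (\<lambda>n. (1/3) ^ Suc k * (1/3) ^ n)"
    by (simp add: power_add mult_ac)
  also have "\<dots> = (1/3) ^ Suc k * (3/2)"
    using geo by (simp add: suminf_mult suminf_geometric del: power_Suc)
  finally have "\<bar>?t\<bar> \<le> (1/3) ^ k / 2" by simp
  moreover have "\<bar>d k * (1/3) ^ k\<bar> = (1/3) ^ k"
    using k by (simp add: abs_mult)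
  ultimately show ?thesis unfolding split by linarith
qed

text \<open>A point is coded by the ternary number whose digits, 0 or 1, tell which balls of a
  countable family contain it. Close codes share many initial digits and so belong to close points.
  Decoding is thus uniformly continuous, although \<open>\<phi>\<close> in general is not
  continuous, and it extends to the closure of the codes and then to the line.\<close>

lemma compact_real_code:
  fixes B :: "'a::euclidean_space set"
  assumes B: "compact B"
  obtains \<theta> :: "real \<Rightarrow> 'a" and \<phi> :: "'a \<Rightarrow> real"
  where "continuous_on UNIV \<theta>" "\<And>x. x \<in> B \<Longrightarrow> \<theta> (\<phi> x) = x" "\<And>x. \<bar>\<phi> x\<bar> \<le> 2"
proof -
  have "\<exists>C. finite C \<and> B \<subseteq> (\<Union>c\<in>C. ball c (1 / real (Suc n)))" for n
    using B by (simp add: compact_eq_totally_bounded)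
  then obtain C where C: "\<And>n. finite (C n)" "\<And>n. B \<subseteq> (\<Union>c\<in>C n. ball c (1 / real (Suc n)))"
    by metis
  define \<U> where "\<U> = (\<Union>n. (\<lambda>c. ball c (1 / real (Suc n))) ` C n)"
  have "countable \<U>"
    unfolding \<U>_def using C(1) by (intro countable_UN countable_image) (auto intro: countable_finite)
  define U where "U = from_nat_into \<U>"
  define b where "b x k = (of_bool (x \<in> U k) :: real)" for x k
  define \<phi> where "\<phi> x = suminf (\<lambda>k. b x k * (1/3) ^ k)" for x
  have geo: "summable (\<lambda>j. (1/3) ^ j :: real)" by (rule summable_geometric) simp
  have sum: "summable (\<lambda>k. b x k * (1/3) ^ k)" for x
    by (rule summable_comparison_test'[OF geo]) (auto simp: b_def)
  have \<phi>_bound: "\<bar>\<phi> x\<bar> \<le> 2" for x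
  proof -
    have "0 \<le> \<phi> x" unfolding \<phi>_def by (intro suminf_nonneg sum) (auto simp: b_def)
    moreover have "\<phi> x \<le> suminf (\<lambda>k. (1/3) ^ k)"
      unfolding \<phi>_def by (intro suminf_le sum geo) (auto simp: b_def)
    ultimately show ?thesis by (simp add: suminf_geometric)
  qed
  have agree: "x \<in> U k \<longleftrightarrow> y \<in> U k" if less: "\<bar>\<phi> x - \<phi> y\<bar> < (1/3) ^ N / 2" and "k \<le> N" for x y k N
  proof (rule ccontr)
    assume k: "\<not> (x \<in> U k \<longleftrightarrow> y \<in> U k)"
    \<comment> \<open>The first digit in which the two codes differ controls their distance from
      below.\<close>
    define m where "m = (LEAST k. \<not> (x \<in> U k \<longleftrightarrow> y \<in> U k))"
    have m: "\<not> (x \<in> U m \<longleftrightarrow> y \<in> U m)" "m \<le> k"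
      unfolding m_def using k by (rule LeastI, intro Least_le)
    have eq: "x \<in> U j \<longleftrightarrow> y \<in> U j" if "j < m" for j
      using not_less_Least[OF that[unfolded m_def]] by simp
    have "(1/3) ^ m / 2 \<le> \<bar>suminf (\<lambda>j. (b x j - b y j) * (1/3) ^ j)\<bar>"
      using m(1) eq by (intro abs_ternary_ge) (auto simp: b_def)
    also have "suminf (\<lambda>j. (b x j - b y j) * (1/3) ^ j) = \<phi> x - \<phi> y"
      unfolding \<phi>_def by (simp add: suminf_diff[OF sum sum] left_diff_distrib)
    also have "\<bar>\<dots>\<bar> < (1/3) ^ N / 2" by (rule less)
    also have "\<dots> \<le> (1/3) ^ m / 2"
      using m(2) that(2) by (intro divide_right_mono power_decreasing) auto
    finally show False by simp
  qed
  have near: "\<exists>d>0. \<forall>x\<in>B. \<forall>y\<in>B. \<bar>\<phi> x - \<phi> y\<bar> < d \<longrightarrow> dist x y < e" if e: "0 < e" for e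
  proof -
    obtain n where n: "1 / real (Suc n) < e / 2"
      using e by (metis half_gt_zero inverse_eq_divide reals_Archimedean)
    have "\<exists>k. ball c (1 / real (Suc n)) = U k" if "c \<in> C n" for c
    proof -
      have "ball c (1 / real (Suc n)) \<in> \<U>" using that by (auto simp: \<U>_def)
      with \<open>countable \<U>\<close> show ?thesis
        unfolding U_def using from_nat_into_surj[of \<U>] by metis
    qed
    then obtain \<kappa> where \<kappa>: "\<And>c. c \<in> C n \<Longrightarrow> ball c (1 / real (Suc n)) = U (\<kappa> c)"
      by metis
    \<comment> \<open>Codes that agree up to the largest index of the finitely many covering balls
      put both points into a common ball of radius below e/2. The inserted 0 keeps
      \<open>Max\<close> defined when \<open>C n\<close> is empty.\<close>
    define N where "N = Max (insert 0 (\<kappa> ` C n))"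
    have N: "\<kappa> c \<le> N" if "c \<in> C n" for c
      unfolding N_def using C(1) that by (intro Max_ge) auto
    have "dist x y < e" if "x \<in> B" "\<bar>\<phi> x - \<phi> y\<bar> < (1/3) ^ N / 2" for x y
    proof -
      obtain c where c: "c \<in> C n" "x \<in> ball c (1 / real (Suc n))" using C(2)[of n] \<open>x \<in> B\<close> by blast
      then have "y \<in> ball c (1 / real (Suc n))"
        using agree[OF that(2) N[OF c(1)]] unfolding \<kappa>[OF c(1)] by simp
      with c n show ?thesis using dist_triangle2[of x y c] by (simp add: dist_commute)
    qed
    then show ?thesis by (intro exI[of _ "(1/3) ^ N / 2"]) auto
  qed
  have inj: "inj_on \<phi> B"
  proof (rule inj_onI, rule ccontr)
    fix x y assume *: "x \<in> B" "y \<in> B" "\<phi> x = \<phi> y" "x \<noteq> y"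
    then obtain d where "0 < d" "\<bar>\<phi> x - \<phi> y\<bar> < d \<longrightarrow> dist x y < dist x y"
      using near[of "dist x y"] by (metis zero_less_dist_iff)
    with * show False by simp
  qed
  have "uniformly_continuous_on (\<phi> ` B) (inv_into B \<phi>)"
    unfolding uniformly_continuous_on_def
    using near inj by (simp add: dist_real_def abs_minus_commute) (metis dist_commute)
  then obtain g where g: "uniformly_continuous_on (closure (\<phi> ` B)) g"
    "\<And>t. t \<in> \<phi> ` B \<Longrightarrow> inv_into B \<phi> t = g t"
    by (rule uniformly_continuous_on_extension_on_closure) blast
  \<comment> \<open>Dugundji's theorem extends a continuous map from a closed subset of the line to
    the whole line.\<close>
  obtain \<theta> where "continuous_on UNIV \<theta>" "\<And>t. t \<in> closure (\<phi> ` B) \<Longrightarrow> \<theta> t = g t"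
    by (rule Dugundji[of UNIV UNIV "closure (\<phi> ` B)" g])
      (use uniformly_continuous_imp_continuous[OF g(1)] in auto)
  moreover have "\<theta> (\<phi> x) = x" if "x \<in> B" for x
    using calculation(2)[of "\<phi> x"] g(2)[of "\<phi> x"] that inj closure_subset[of "\<phi> ` B"] by (auto simp: subset_iff)
  ultimately show thesis using that \<phi>_bound by blast
qed

section \<open>Positive functionals on continuous functions\<close>

text \<open>The space is shrunk into the unit ball by \<open>\<beta>\<close>, coded on the line by
  \<open>\<phi>\<close>, and recovered from codes by \<open>\<gamma>\<close> after
  \<open>\<theta>\<close>. Codes decoded outside the open ball are discarded: their mass corresponds
  to mass escaping to infinity, which functions with compact support do not see.\<close>

lemma riesz_compact_support:
  fixes L :: "('a::euclidean_space \<Rightarrow> real) \<Rightarrow> real"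
  assumes lin: "linear L"
    and pos: "\<And>f. bounded (range f) \<Longrightarrow> (\<And>x. 0 \<le> f x) \<Longrightarrow> 0 \<le> L f"
  obtains \<mu> where "finite_measure \<mu>" "sets \<mu> = sets borel"
    "\<And>C f. compact C \<Longrightarrow> continuous_on UNIV f \<Longrightarrow> (\<And>x. x \<notin> C \<Longrightarrow> f x = 0) \<Longrightarrow>
      integral\<^sup>L \<mu> f = L f"
proof -
  obtain \<gamma> and \<beta> :: "'a \<Rightarrow> 'a" where hom: "homeomorphism (ball 0 1) UNIV \<gamma> \<beta>"
    using homeomorphic_ball01_UNIV unfolding homeomorphic_def by blast
  obtain \<theta> :: "real \<Rightarrow> 'a" and \<phi> where \<theta>: "continuous_on UNIV \<theta>"
    and code: "\<And>x. x \<in> cball 0 1 \<Longrightarrow> \<theta> (\<phi> x) = x" and \<phi>: "\<And>x. \<bar>\<phi> x\<bar> \<le> 2"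
    using compact_real_code[OF compact_cball] by blast
  obtain \<rho> where \<rho>: "finite_measure \<rho>" "sets \<rho> = sets borel"
    and int: "\<And>h :: real \<Rightarrow> real. continuous_on UNIV h \<Longrightarrow> bounded (range h) \<Longrightarrow>
      integral\<^sup>L \<rho> h = L (\<lambda>x. h (\<phi> (\<beta> x)))"
    using riesz_bounded_real_function[OF lin pos, of "\<lambda>x. \<phi> (\<beta> x)" 2] \<phi> by blast
  have \<beta>1: "\<beta> x \<in> ball 0 1" for x
    using homeomorphism_image2[OF hom] by blast
  have \<beta>: "\<beta> x \<in> ball 0 1" "\<gamma> (\<beta> x) = x" "\<theta> (\<phi> (\<beta> x)) = \<beta> x" for x
    using \<beta>1[of x] homeomorphism_apply2[OF hom, of x] code[of "\<beta> x"] by auto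
  define S where "S = \<theta> -` ball 0 1"
  have "open S"
    unfolding S_def using \<theta> by (intro open_vimage) auto
  then have S: "S \<in> sets \<rho>" using \<rho>(2) by simp
  have "continuous_on S (\<lambda>t. \<gamma> (\<theta> t))"
    using homeomorphism_cont1[OF hom] continuous_on_subset[OF \<theta>]
    by (rule continuous_on_compose2) (auto simp: S_def)
  then have "(\<lambda>t. \<gamma> (\<theta> t)) \<in> borel_measurable (restrict_space borel S)"
    by (rule borel_measurable_continuous_on_restrict)
  then have meas: "(\<lambda>t. \<gamma> (\<theta> t)) \<in> borel_measurable (restrict_space \<rho> S)"
    using sets_restrict_space_cong[OF \<rho>(2)] by (simp cong: measurable_cong_sets)
  let ?\<mu> = "distr (restrict_space \<rho> S) borel (\<lambda>t. \<gamma> (\<theta> t))"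
  show thesis
  proof (rule that)
    show "finite_measure ?\<mu>"
      using finite_measure.finite_measure_distr[OF finite_measure_restrict_space[OF \<rho>(1) S] meas] .
    show "sets ?\<mu> = sets borel" by simp
  next
    fix C and f :: "'a \<Rightarrow> real"
    assume C: "compact C" and f: "continuous_on UNIV f" and f0: "\<And>x. x \<notin> C \<Longrightarrow> f x = 0"
    \<comment> \<open>\<open>f\<close> carried to the ball and continued by 0. Continuity is glued
      from two open sets, the ball and the complement of the image of \<open>C\<close> under
      \<open>\<beta>\<close>; on the latter \<open>h\<close> is 0.\<close>
    define h where "h z = (if z \<in> ball 0 1 then f (\<gamma> z) else 0)" for z
    have "compact (\<beta> ` C)"
      using C homeomorphism_cont2[OF hom] by (intro compact_continuous_image) (auto intro: continuous_on_subset)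
    then have "open (- (\<beta> ` C))" by (simp add: compact_imp_closed open_Compl)
    moreover have "continuous_on (ball 0 1) h"
      using continuous_on_compose2[OF f homeomorphism_cont1[OF hom]]
      by (rule continuous_on_cong[THEN iffD1, rotated -1]) (auto simp: h_def)
    moreover have h0: "h z = 0" if "z \<notin> \<beta> ` C" for z
      using that f0[of "\<gamma> z"] homeomorphism_apply1[OF hom, of z] by (force simp: h_def)
    then have "continuous_on (- (\<beta> ` C)) h"
      by (intro continuous_on_cong[THEN iffD1, OF refl _ continuous_on_const[of _ 0]]) auto
    ultimately have "continuous_on (ball 0 1 \<union> - (\<beta> ` C)) h"
      by (intro continuous_on_open_Un) auto
    moreover have "ball 0 1 \<union> - (\<beta> ` C) = UNIV" using \<beta>(1) by auto
    ultimately have h: "continuous_on UNIV h" by simp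
    have "range h \<subseteq> insert 0 (h ` (\<beta> ` C))" using h0 by auto
    moreover have "compact (h ` (\<beta> ` C))"
      by (rule compact_continuous_image[OF continuous_on_subset[OF h] \<open>compact (\<beta> ` C)\<close>]) simp
    ultimately have "bounded (range h)"
      by (meson bounded_insert bounded_subset compact_imp_bounded)
    then have bdd: "bounded (range (\<lambda>t. h (\<theta> t)))"
      by (rule bounded_subset) auto
    have "integral\<^sup>L ?\<mu> f = (\<integral>t. indicator S t *\<^sub>R f (\<gamma> (\<theta> t)) \<partial>\<rho>)"
      using S f meas by (subst integral_distr)
        (auto simp: integral_restrict_space sets_eq_imp_space_eq[OF \<rho>(2)] intro: borel_measurable_continuous_onI)
    also have "(\<lambda>t. indicator S t *\<^sub>R f (\<gamma> (\<theta> t))) = (\<lambda>t. h (\<theta> t))"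
      by (auto simp: h_def S_def indicator_def)
    also have "integral\<^sup>L \<rho> (\<lambda>t. h (\<theta> t)) = L (\<lambda>x. h (\<theta> (\<phi> (\<beta> x))))"
      using bdd by (intro int continuous_on_compose2[OF h \<theta>]) auto
    also have "(\<lambda>x. h (\<theta> (\<phi> (\<beta> x)))) = f"
      using \<beta> by (auto simp: h_def)
    finally show "integral\<^sup>L ?\<mu> f = L f" .
  qed
qed

text \<open>This is Hahn-Banach for the sublinear \<open>p f\<close>, the infimum of
  \<open>L\<close> over the majorants of \<open>f\<close> on \<open>K\<close> taken from
  \<open>A\<close>. Positivity comes from 0 being a majorant of \<open>- f\<close>. The majorant
  \<open>g\<close> in the last conclusion puts \<open>f\<close> into the space \<open>E\<close> of
  dominated functions.\<close>

lemma positive_functional_extension: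
  fixes A :: "('a \<Rightarrow> real) set" and L :: "('a \<Rightarrow> real) \<Rightarrow> real"
  assumes A: "subspace A"
    and dom: "\<And>f. f \<in> A \<Longrightarrow> \<exists>g\<in>A. \<forall>x\<in>K. \<bar>f x\<bar> \<le> g x"
    and add: "\<And>f g. f \<in> A \<Longrightarrow> g \<in> A \<Longrightarrow> L (f + g) = L f + L g"
    and scale: "\<And>c f. f \<in> A \<Longrightarrow> L (c *\<^sub>R f) = c * L f"
    and pos: "\<And>f. f \<in> A \<Longrightarrow> (\<And>x. x \<in> K \<Longrightarrow> 0 \<le> f x) \<Longrightarrow> 0 \<le> L f"
  obtains \<Lambda> where "linear \<Lambda>" "\<And>f. f \<in> A \<Longrightarrow> \<Lambda> f = L f"
    "\<And>f g. g \<in> A \<Longrightarrow> (\<And>x. x \<in> K \<Longrightarrow> 0 \<le> f x) \<Longrightarrow> (\<And>x. x \<in> K \<Longrightarrow> f x \<le> g x) \<Longrightarrow> 0 \<le> \<Lambda> f"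
proof -
  define E where "E = {f. \<exists>g\<in>A. \<forall>x\<in>K. \<bar>f x\<bar> \<le> g x}"
  have E: "subspace E"
  proof (rule subspaceI)
    show "0 \<in> E" using subspace_0[OF A] by (auto simp: E_def intro!: bexI[of _ 0])
  next
    fix f g assume "f \<in> E" "g \<in> E"
    then obtain f' g' where "f' \<in> A" "g' \<in> A" "\<forall>x\<in>K. \<bar>f x\<bar> \<le> f' x" "\<forall>x\<in>K. \<bar>g x\<bar> \<le> g' x"
      by (auto simp: E_def)
    then show "f + g \<in> E"
      using subspace_add[OF A, of f' g'] by (force simp: E_def intro!: bexI[of _ "f' + g'"])
  next
    fix c f assume "f \<in> E"
    then obtain f' where "f' \<in> A" "\<forall>x\<in>K. \<bar>f x\<bar> \<le> f' x"
      by (auto simp: E_def)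
    then show "c *\<^sub>R f \<in> E"
      using subspace_scale[OF A, of f' "\<bar>c\<bar>"]
      by (auto simp: E_def abs_mult mult_left_mono intro!: bexI[of _ "\<bar>c\<bar> *\<^sub>R f'"])
  qed
  have L0: "L 0 = 0" using scale[OF subspace_0[OF A], of 0] by simp
  have Lneg: "L (- f) = - L f" if "f \<in> A" for f using scale[OF that, of "- 1"] by simp
  \<comment> \<open>A linear projection onto \<open>E\<close>. Composing with it makes
    \<open>p\<close> sublinear on the whole function type, where
    \<open>sublinear_dominates_linear\<close> operates.\<close>
  obtain \<pi> where \<pi>: "linear \<pi>" "range \<pi> \<subseteq> E" "\<And>f. f \<in> E \<Longrightarrow> \<pi> f = f"
    using linear_exists_left_inverse_on[OF linear_id E] by auto
  define U where "U f = {g \<in> A. \<forall>x\<in>K. \<pi> f x \<le> g x}" for f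
  define p where "p f = (INF g\<in>U f. L g)" for f
  have ne: "U f \<noteq> {}" and bdd: "bdd_below (L ` U f)" for f
  proof -
    obtain g0 where g0: "g0 \<in> A" "\<forall>x\<in>K. \<bar>\<pi> f x\<bar> \<le> g0 x"
      using \<pi>(2) by (auto simp: E_def)
    then show "U f \<noteq> {}" by (force simp: U_def)
    \<comment> \<open>A majorant of \<open>\<pi> f\<close> becomes nonnegative on \<open>K\<close>
      once \<open>g0\<close> is added, which bounds the infimum from below.\<close>
    have "- L g0 \<le> L g" if "g \<in> U f" for g
    proof -
      have "0 \<le> L (g + g0)"
      proof (rule pos)
        fix x assume "x \<in> K"
        then have "\<bar>\<pi> f x\<bar> \<le> g0 x" "\<pi> f x \<le> g x" using g0(2) that by (auto simp: U_def)
        then show "0 \<le> (g + g0) x" by (simp add: abs_le_iff)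
      qed (use that g0(1) A in \<open>auto simp: U_def subspace_add\<close>)
      then show ?thesis using add g0(1) that by (simp add: U_def)
    qed
    then show "bdd_below (L ` U f)" by (intro bdd_belowI[of _ "- L g0"]) auto
  qed
  have ple: "p f \<le> L g" if "g \<in> U f" for f g
    unfolding p_def using bdd that by (rule cINF_lower)
  have pge: "c \<le> p f" if "\<And>g. g \<in> U f \<Longrightarrow> c \<le> L g" for c f
    unfolding p_def using ne that by (rule cINF_greatest)
  have "sublinear p"
    unfolding sublinear_def
  proof (intro conjI allI impI)
    fix f f'
    have *: "p (f + f') \<le> L g + L g'" if "g \<in> U f" "g' \<in> U f'" for g g'
    proof -
      have "g + g' \<in> U (f + f')"
        using that subspace_add[OF A] by (auto simp: U_def linear_add[OF \<pi>(1)] intro: add_mono)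
      from ple[OF this] show ?thesis using add that by (simp add: U_def)
    qed
    have "p (f + f') - L g' \<le> p f" if "g' \<in> U f'" for g'
      using *[OF _ that] by (intro pge) (simp add: algebra_simps)
    then have "p (f + f') - p f \<le> p f'"
      by (intro pge) (simp add: algebra_simps)
    then show "p (f + f') \<le> p f + p f'" by simp
  next
    have *: "p (c *\<^sub>R f) \<le> c * p f" if c: "0 < c" for c f
    proof -
      have "p (c *\<^sub>R f) / c \<le> p f"
      proof (rule pge)
        fix g assume g: "g \<in> U f"
        then have "c *\<^sub>R g \<in> U (c *\<^sub>R f)"
          using c subspace_scale[OF A] by (auto simp: U_def linear_scale[OF \<pi>(1)])
        from ple[OF this] show "p (c *\<^sub>R f) / c \<le> L g"
          using scale g c by (simp add: U_def field_simps)
      qed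
      then show ?thesis using c by (simp add: field_simps)
    qed
    fix c :: real and f :: "'a \<Rightarrow> real" assume c: "0 < c"
    have "p ((1 / c) *\<^sub>R (c *\<^sub>R f)) \<le> (1 / c) * p (c *\<^sub>R f)"
      using c by (intro *) simp
    with *[OF c, of f] c show "p (c *\<^sub>R f) = c * p f"
      by (simp add: field_simps)
  qed
  then obtain \<Lambda> where \<Lambda>: "linear \<Lambda>" "\<Lambda> \<le> p" by (rule sublinear_dominates_linear)
  have \<Lambda>le: "\<Lambda> f \<le> L g" if "f \<in> E" "g \<in> A" "\<And>x. x \<in> K \<Longrightarrow> f x \<le> g x" for f g
  proof -
    have "g \<in> U f" using that \<pi>(3) by (simp add: U_def)
    from le_funD[OF \<Lambda>(2)] ple[OF this] show ?thesis by (rule order_trans)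
  qed
  have AE: "A \<subseteq> E" using dom by (auto simp: E_def)
  show thesis
  proof (rule that[OF \<Lambda>(1)])
    fix f assume f: "f \<in> A"
    have "\<Lambda> f \<le> L f" using f AE by (intro \<Lambda>le) auto
    moreover have "\<Lambda> (- f) \<le> L (- f)" using subspace_neg[OF A f] AE by (intro \<Lambda>le) auto
    ultimately show "\<Lambda> f = L f" using linear_neg[OF \<Lambda>(1), of f] Lneg[OF f] by simp
  next
    fix f g :: "'a \<Rightarrow> real" assume g: "g \<in> A" "\<And>x. x \<in> K \<Longrightarrow> 0 \<le> f x" "\<And>x. x \<in> K \<Longrightarrow> f x \<le> g x"
    then have "f \<in> E" by (auto simp: E_def intro!: bexI[of _ g])
    then have "\<Lambda> (- f) \<le> L 0"
      using subspace_neg[OF E] subspace_0[OF A] g(2) by (intro \<Lambda>le) auto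
    then show "0 \<le> \<Lambda> f" using linear_neg[OF \<Lambda>(1), of f] L0 by simp
  qed
qed

text \<open>The growth condition \<open>dom\<close> prevents mass from being lost at infinity:
  beyond radius k the function \<open>f\<close> is at most g/(k + 1) in absolute value, so cutting
  it off there changes the functional by at most L g/(k + 1).\<close>

theorem haviland:
  fixes A :: "('a::euclidean_space \<Rightarrow> real) set" and L :: "('a \<Rightarrow> real) \<Rightarrow> real"
  assumes A: "subspace A" and one: "(\<lambda>_. 1) \<in> A"
    and cont: "\<And>f. f \<in> A \<Longrightarrow> continuous_on UNIV f"
    and dom: "\<And>f. f \<in> A \<Longrightarrow> \<exists>g\<in>A. \<forall>x. (1 + norm x) * \<bar>f x\<bar> \<le> g x"
    and add: "\<And>f g. f \<in> A \<Longrightarrow> g \<in> A \<Longrightarrow> L (f + g) = L f + L g"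
    and scale: "\<And>c f. f \<in> A \<Longrightarrow> L (c *\<^sub>R f) = c * L f"
    and K: "closed K"
    and pos: "\<And>f. f \<in> A \<Longrightarrow> (\<And>x. x \<in> K \<Longrightarrow> 0 \<le> f x) \<Longrightarrow> 0 \<le> L f"
  obtains \<mu> where "finite_measure \<mu>" "sets \<mu> = sets borel" "AE x in \<mu>. x \<in> K"
    "\<And>f. f \<in> A \<Longrightarrow> integrable \<mu> f \<and> integral\<^sup>L \<mu> f = L f"
proof -
  have dom': "\<exists>g\<in>A. \<forall>x\<in>K. \<bar>f x\<bar> \<le> g x" if "f \<in> A" for f
  proof -
    from dom[OF that] obtain g where g: "g \<in> A" "\<And>x. (1 + norm x) * \<bar>f x\<bar> \<le> g x" by blast
    have "\<bar>f x\<bar> \<le> g x" for x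
      using g(2)[of x] mult_right_mono[of 1 "1 + norm x" "\<bar>f x\<bar>"] by simp
    with g(1) show ?thesis by blast
  qed
  obtain \<Lambda> where lin: "linear \<Lambda>" and ext: "\<And>f. f \<in> A \<Longrightarrow> \<Lambda> f = L f"
    and \<Lambda>_pos: "\<And>f g. g \<in> A \<Longrightarrow> (\<And>x. x \<in> K \<Longrightarrow> 0 \<le> f x) \<Longrightarrow> (\<And>x. x \<in> K \<Longrightarrow> f x \<le> g x) \<Longrightarrow> 0 \<le> \<Lambda> f"
    using positive_functional_extension[OF A dom' add scale pos] by blast
  have \<Lambda>_diff: "\<Lambda> (\<lambda>x. f x - g x) = \<Lambda> f - \<Lambda> g" for f g
    using linear_diff[OF lin, of f g] by (simp add: fun_diff_def)
  have \<Lambda>_bdd: "0 \<le> \<Lambda> f" if bdd: "bounded (range f)" and nonneg: "\<And>x. x \<in> K \<Longrightarrow> 0 \<le> f x" for f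
  proof -
    obtain b where b: "\<And>x. \<bar>f x\<bar> \<le> b" using bdd by (auto simp: bounded_iff)
    show ?thesis
    proof (rule \<Lambda>_pos)
      show "b *\<^sub>R (\<lambda>_. 1) \<in> A" using A one by (rule subspace_scale)
      show "f x \<le> (b *\<^sub>R (\<lambda>_. 1)) x" for x using b[of x] by (simp add: abs_le_iff)
    qed (rule nonneg)
  qed
  obtain \<mu> where \<mu>: "finite_measure \<mu>" "sets \<mu> = sets borel"
    and int: "\<And>C f. compact C \<Longrightarrow> continuous_on UNIV f \<Longrightarrow> (\<And>x. x \<notin> C \<Longrightarrow> f x = 0) \<Longrightarrow>
      integral\<^sup>L \<mu> f = \<Lambda> f"
    using riesz_compact_support[OF lin \<Lambda>_bdd] by blast
  interpret finite_measure \<mu> by fact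

  \<comment> \<open>Cut-off functions and truncated integrals\<close>
  define cut where "cut k x = max 0 (min 1 (real k + 1 - norm x))" for k and x :: 'a
  have cut01: "0 \<le> cut k x" "cut k x \<le> 1" for k x by (auto simp: cut_def)
  have cut_mono: "cut k x \<le> cut l x" if "k \<le> l" for k l x using that by (auto simp: cut_def)
  have cut1: "cut k x = 1" if "norm x \<le> real k" for k x using that by (simp add: cut_def)
  have cut_lim: "(\<lambda>k. cut k x) \<longlonglongrightarrow> 1" for x
  proof (rule tendsto_eventually)
    obtain k0 where "norm x \<le> real k0" using real_arch_simple by blast
    then show "\<forall>\<^sub>F k in sequentially. cut k x = 1"
      using cut1 by (intro eventually_sequentiallyI[of k0]) (auto intro: order_trans)
  qed
  have cut_cont: "continuous_on UNIV (\<lambda>x. cut k x * f x)" if "continuous_on UNIV f" for k f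
    unfolding cut_def using that by (intro continuous_intros)
  have cut_zero: "cut k x * c = 0" if "x \<notin> cball 0 (real k + 1)" for k x c
    using that by (simp add: cut_def)
  have int_cut: "integral\<^sup>L \<mu> (\<lambda>x. cut k x * f x) = \<Lambda> (\<lambda>x. cut k x * f x)"
    if "continuous_on UNIV f" for k f
    using compact_cball cut_cont[OF that] cut_zero by (rule int)
  have bdd_cut: "bounded (range (\<lambda>x. cut k x * f x))" if f: "continuous_on UNIV f" for k f
  proof -
    have "compact ((\<lambda>x. cut k x * f x) ` cball 0 (real k + 1))"
      using cut_cont[OF f] by (intro compact_continuous_image) (auto intro: continuous_on_subset)
    moreover have "range (\<lambda>x. cut k x * f x) \<subseteq> insert 0 ((\<lambda>x. cut k x * f x) ` cball 0 (real k + 1))"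
      using cut_zero by force
    ultimately show ?thesis by (meson bounded_insert bounded_subset compact_imp_bounded)
  qed
  have measb: "f \<in> borel_measurable \<mu>" if "continuous_on UNIV f" for f :: "'a \<Rightarrow> real"
    using borel_measurable_continuous_onI[OF that] \<mu>(2) by (simp cong: measurable_cong_sets)
  have integrable_cut: "integrable \<mu> (\<lambda>x. cut k x * f x)" if f: "continuous_on UNIV f" for k f
  proof -
    obtain b where "\<And>x. norm (cut k x * f x) \<le> b" using bdd_cut[OF f, of k] by (auto simp: bounded_iff)
    then show ?thesis using measb[OF cut_cont[OF f]] by (intro integrable_const_bound) auto
  qed

  \<comment> \<open>Concentration of the measure on \<open>K\<close>\<close>
  define d where "d x = (if K = {} then 1 else infdist x K)" for x
  have d: "continuous_on UNIV d" "\<And>x. 0 \<le> d x" "\<And>x. x \<in> K \<Longrightarrow> d x = 0"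
    unfolding d_def by (cases "K = {}"; auto intro!: continuous_intros infdist_nonneg)+
  \<comment> \<open>Here the value 1 of \<open>d\<close> for empty \<open>K\<close> matters:
    \<open>infdist\<close> to the empty set is 0 and would place every point in
    \<open>K\<close>.\<close>
  have dK: "x \<in> K" if "d x = 0" for x
    using that in_closed_iff_infdist_zero[OF K, of x] by (auto simp: d_def split: if_splits)
  have "AE x in \<mu>. cut k x * d x = 0" for k
  proof -
    \<comment> \<open>The truncated distance vanishes on \<open>K\<close>, so positivity on
      \<open>K\<close> applies both to it and to its negative.\<close>
    have "0 \<le> \<Lambda> (- (\<lambda>x. cut k x * d x))"
      using bdd_cut[OF d(1), of k] d(3) by (intro \<Lambda>_bdd) (auto simp: bounded_iff)
    moreover have "0 \<le> \<Lambda> (\<lambda>x. cut k x * d x)"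
      using bdd_cut[OF d(1), of k] d(3) by (intro \<Lambda>_bdd) auto
    ultimately have "integral\<^sup>L \<mu> (\<lambda>x. cut k x * d x) = 0"
      using int_cut[OF d(1)] linear_neg[OF lin, of "\<lambda>x. cut k x * d x"] by simp
    then show ?thesis
      using integral_nonneg_eq_0_iff_AE[OF integrable_cut[OF d(1)]] cut01 d(2) by simp
  qed
  then have "AE x in \<mu>. \<forall>k. cut k x * d x = 0" unfolding AE_all_countable by blast
  then have AE: "AE x in \<mu>. x \<in> K"
  proof eventually_elim
    case (elim x)
    obtain k where "norm x \<le> real k" using real_arch_simple by blast
    with elim cut1 show ?case by (intro dK) (metis mult_1)
  qed

  \<comment> \<open>Integrability and integrals of the functions in \<open>A\<close>\<close>
  have "integrable \<mu> f \<and> integral\<^sup>L \<mu> f = L f" if f: "f \<in> A" for f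
  proof -
    from dom[OF f] obtain g where g: "g \<in> A" "\<And>x. (1 + norm x) * \<bar>f x\<bar> \<le> g x" by blast
    have fg: "\<bar>f x\<bar> \<le> g x" for x
      using g(2)[of x] mult_right_mono[of 1 "1 + norm x" "\<bar>f x\<bar>"] by simp
    note fc = cont[OF f]
    have absc: "continuous_on UNIV (\<lambda>x. \<bar>f x\<bar>)" using fc by (intro continuous_intros)
    \<comment> \<open>The truncations of |f| stay below \<open>g\<close>, so their integrals have
      the common bound \<open>L g\<close>; monotone convergence then gives integrability of
      \<open>f\<close>.\<close>
    have bound: "(\<integral>\<^sup>+x. ennreal (cut k x * \<bar>f x\<bar>) \<partial>\<mu>) \<le> ennreal (L g)" for k
    proof -
      have "(\<integral>\<^sup>+x. ennreal (cut k x * \<bar>f x\<bar>) \<partial>\<mu>) = ennreal (\<Lambda> (\<lambda>x. cut k x * \<bar>f x\<bar>))"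
        using int_cut[OF absc] by (subst nn_integral_eq_integral[OF integrable_cut[OF absc]]) (auto simp: cut01)
      also have "0 \<le> \<Lambda> (\<lambda>x. g x - cut k x * \<bar>f x\<bar>)"
      proof (rule \<Lambda>_pos[OF g(1)])
        show "0 \<le> g x - cut k x * \<bar>f x\<bar>" for x
          using mult_right_mono[OF cut01(2), of "\<bar>f x\<bar>" k x] fg[of x] by simp
      qed (simp add: cut01)
      then have "\<Lambda> (\<lambda>x. cut k x * \<bar>f x\<bar>) \<le> L g"
        using ext[OF g(1)] by (simp add: \<Lambda>_diff)
      finally show ?thesis by (simp add: ennreal_leI)
    qed
    have incs: "incseq (\<lambda>k. ennreal (cut k x * \<bar>f x\<bar>))" for x
      by (auto simp: incseq_def intro!: ennreal_leI mult_right_mono cut_mono)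
    have sup: "(SUP k. ennreal (cut k x * \<bar>f x\<bar>)) = ennreal \<bar>f x\<bar>" for x
    proof (rule LIMSEQ_unique)
      show "(\<lambda>k. ennreal (cut k x * \<bar>f x\<bar>)) \<longlonglongrightarrow> (SUP k. ennreal (cut k x * \<bar>f x\<bar>))"
        using incs by (rule LIMSEQ_SUP)
      show "(\<lambda>k. ennreal (cut k x * \<bar>f x\<bar>)) \<longlonglongrightarrow> ennreal \<bar>f x\<bar>"
        using tendsto_mult[OF cut_lim tendsto_const, of x "\<bar>f x\<bar>"] by (intro tendsto_ennrealI) simp
    qed
    have "(\<integral>\<^sup>+x. ennreal \<bar>f x\<bar> \<partial>\<mu>) = (SUP k. \<integral>\<^sup>+x. ennreal (cut k x * \<bar>f x\<bar>) \<partial>\<mu>)"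
      unfolding sup[symmetric]
    proof (rule nn_integral_monotone_convergence_SUP)
      show "incseq (\<lambda>k x. ennreal (cut k x * \<bar>f x\<bar>))"
        using incs by (simp add: incseq_def le_fun_def)
      show "(\<lambda>x. ennreal (cut k x * \<bar>f x\<bar>)) \<in> borel_measurable \<mu>" for k
        using measb[OF cut_cont[OF absc]] by measurable
    qed
    also have "\<dots> \<le> ennreal (L g)" using bound by (rule SUP_least)
    finally have "(\<integral>\<^sup>+x. ennreal (norm (f x)) \<partial>\<mu>) < \<infinity>"
      by (simp add: le_less_trans)
    then have fi: "integrable \<mu> f" using measb[OF fc] by (intro integrableI_bounded)
    have "(\<lambda>k. integral\<^sup>L \<mu> (\<lambda>x. cut k x * f x)) \<longlonglongrightarrow> integral\<^sup>L \<mu> f"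
    proof (rule integral_dominated_convergence[where w = "\<lambda>x. \<bar>f x\<bar>"])
      show "AE x in \<mu>. (\<lambda>k. cut k x * f x) \<longlonglongrightarrow> f x"
        using tendsto_mult[OF cut_lim tendsto_const] by (intro AE_I2) fastforce
      show "AE x in \<mu>. norm (cut k x * f x) \<le> \<bar>f x\<bar>" for k
        using cut01 by (intro AE_I2) (simp add: abs_mult mult_left_le_one_le)
    qed (use measb fc cut_cont fi in auto)
    moreover have "(\<lambda>k. \<Lambda> (\<lambda>x. cut k x * f x)) \<longlonglongrightarrow> L f"
    proof (rule LIM_zero_cancel, rule Lim_null_comparison)
      show "(\<lambda>k. L g / real (Suc k)) \<longlonglongrightarrow> 0"
        using tendsto_mult_right_zero[OF LIMSEQ_inverse_real_of_nat, of "L g"] by (simp add: divide_inverse)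
      have "\<bar>\<Lambda> (\<lambda>x. cut k x * f x) - L f\<bar> \<le> L g / real (Suc k)" for k
      proof -
        define G where "G = (1 / real (Suc k)) *\<^sub>R g"
        have gA: "G \<in> A" unfolding G_def using A g(1) by (rule subspace_scale)
        have \<Lambda>g: "\<Lambda> G = L g / real (Suc k)"
          using ext[OF gA] scale[OF g(1)] by (simp add: G_def)
        have close: "\<bar>f x - cut k x * f x\<bar> \<le> G x" for x
        proof -
          \<comment> \<open>Inside the ball of radius k the left side is 0; outside, k + 1 is below
            1 + |x|.\<close>
          have "(1 - cut k x) * real (Suc k) \<le> 1 + norm x"
          proof (cases "norm x \<le> real k")
            case False
            have "(1 - cut k x) * real (Suc k) \<le> 1 * real (Suc k)"
              using cut01 by (intro mult_right_mono) auto
            also have "\<dots> \<le> 1 + norm x" using False by simp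
            finally show ?thesis .
          qed (simp add: cut1)
          then have "(1 - cut k x) * real (Suc k) * \<bar>f x\<bar> \<le> g x"
            using g(2)[of x] mult_right_mono[of _ "1 + norm x" "\<bar>f x\<bar>"] by (meson abs_ge_zero order_trans)
          moreover have "\<bar>f x - cut k x * f x\<bar> = (1 - cut k x) * \<bar>f x\<bar>"
            using cut01(2)[of k x] abs_mult[of "1 - cut k x" "f x"] by (simp add: left_diff_distrib)
          ultimately show ?thesis by (simp add: G_def pos_le_divide_eq mult_ac del: of_nat_Suc)
        qed
        have "0 \<le> \<Lambda> (\<lambda>x. G x - (f x - cut k x * f x))" "0 \<le> \<Lambda> (\<lambda>x. G x - (cut k x * f x - f x))"
        proof -
          \<comment> \<open>Positivity of \<open>\<Lambda>\<close> asks for a majorant from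
            \<open>A\<close>. Since the truncation error is at most \<open>G\<close> in absolute
            value, twice \<open>G\<close> serves for both differences.\<close>
          have g2: "2 *\<^sub>R G \<in> A" using A gA by (rule subspace_scale)
          have "(2 *\<^sub>R G) x = 2 * G x" for x by simp
          then have b: "0 \<le> G x - (f x - cut k x * f x)" "G x - (f x - cut k x * f x) \<le> (2 *\<^sub>R G) x"
            "0 \<le> G x - (cut k x * f x - f x)" "G x - (cut k x * f x - f x) \<le> (2 *\<^sub>R G) x" for x
            using close[of x] by (simp_all add: abs_le_iff)
          show "0 \<le> \<Lambda> (\<lambda>x. G x - (f x - cut k x * f x))"
            using b(1,2) by (rule \<Lambda>_pos[OF g2])
          show "0 \<le> \<Lambda> (\<lambda>x. G x - (cut k x * f x - f x))"
            using b(3,4) by (rule \<Lambda>_pos[OF g2])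
        qed
        then show ?thesis
          unfolding \<Lambda>_diff ext[OF f] using \<Lambda>g by (simp add: abs_le_iff \<Lambda>_diff ext[OF f])
      qed
      then show "\<forall>\<^sub>F k in sequentially. norm (\<Lambda> (\<lambda>x. cut k x * f x) - L f) \<le> L g / real (Suc k)"
        by (intro always_eventually) simp
    qed
    ultimately have "integral\<^sup>L \<mu> f = L f"
      by (simp add: int_cut[OF fc] LIMSEQ_unique)
    with fi show ?thesis by blast
  qed
  with \<mu> AE show thesis by (intro that) auto
qed

section \<open>Quaternionic polynomials\<close>

lemma qcnj_simps [simp]:
  "qcnj 0 = 0" "qcnj 1 = 1" "qcnj (qcnj p) = p" "qcnj (p + q) = qcnj p + qcnj q"
  "qcnj (c *\<^sub>R p) = c *\<^sub>R qcnj p" "qcnj (p * q) = qcnj q * qcnj p"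
  by (simp_all add: quat_eq_iff algebra_simps)

lemma weval_zero [simp]: "weval 0 a = 1"
  by transfer simp

lemma weval_plus [simp]: "weval (u + v) a = weval u a * weval v a"
  by transfer simp

lemma wstar_wstar [simp]: "wstar (wstar w) = w"
  by transfer (simp add: rev_map o_def)

lemma weval_wstar [simp]: "weval (wstar w) a = qcnj (weval w a)"
proof transfer
  fix u and a :: "quat ^ 'n"
  have "letter_eval a (lstar x) = qcnj (letter_eval a x)" for x
    by (cases x) (simp_all add: letter_eval_def)
  then show "prod_list (map (letter_eval a) (rev (map lstar u))) = qcnj (prod_list (map (letter_eval a) u))"
    by (induction u) simp_all
qed

lemma continuous_qRe: "continuous_on S qRe" "continuous_on S qIm1" "continuous_on S qIm2" "continuous_on S qIm3"
  and continuous_qcnj: "continuous_on S qcnj"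
proof -
  have "qRe q = inner q (Quat 1 0 0 0)" "qIm1 q = inner q (Quat 0 1 0 0)"
    "qIm2 q = inner q (Quat 0 0 1 0)" "qIm3 q = inner q (Quat 0 0 0 1)" for q
    by (simp_all add: inner_quat_def)
  then show c: "continuous_on S qRe" "continuous_on S qIm1" "continuous_on S qIm2" "continuous_on S qIm3"
    by (simp_all add: continuous_intros cong: continuous_on_cong)
  have "qcnj q = (2 * qRe q) *\<^sub>R 1 - q" for q
    by (simp add: quat_eq_iff)
  then show "continuous_on S qcnj"
    using c(1) by (auto intro!: continuous_intros cong: continuous_on_cong)
qed

lemma continuous_weval: "continuous_on S (weval w)"
proof (induction w rule: word.abs_induct)
  case (1 u)
  have "continuous_on S (\<lambda>a. letter_eval a x)" for x
  proof (cases x)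
    case (Qbar i)
    have "continuous_on S (\<lambda>a. qcnj (a $ i))"
      by (rule continuous_on_compose2[OF continuous_qcnj[of UNIV]]) (auto intro: continuous_intros)
    with Qbar show ?thesis by (simp add: letter_eval_def)
  qed (simp add: letter_eval_def continuous_intros)
  then have "continuous_on S (\<lambda>a. prod_list (map (letter_eval a) u))"
    by (induction u) (simp_all add: continuous_intros)
  then show ?case by (simp add: weval.abs_eq cong: continuous_on_cong)
qed

text \<open>Updating at a fresh key adds one monomial, so every finitely supported map is a sum of
  monomials. Identities between additive maps on polynomials thereby reduce to single words.\<close>

lemma poly_mapping_single_induct [case_names zero single add]:
  fixes p :: "'a \<Rightarrow>\<^sub>0 'b::comm_monoid_add"
  assumes "P 0" and single: "\<And>w c. P (Poly_Mapping.single w c)"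
    and add: "\<And>p q. P p \<Longrightarrow> P q \<Longrightarrow> P (p + q)"
  shows "P p"
proof (induction p rule: update_induct)
  case (update p a b)
  then have "Poly_Mapping.update a b p = p + Poly_Mapping.single a b"
    by (intro poly_mapping_eqI) (auto simp: lookup_update lookup_add lookup_single in_keys_iff when_def)
  with update.IH show ?case by (simp add: add single)
qed fact

text \<open>Cancellation may remove keys from a sum of polynomials;
  \<open>setsum_keys_plus_distrib\<close> shows that sums over keys remain additive.\<close>

lemma peval_simps [simp]:
  "peval 0 a = 0" "peval (Poly_Mapping.single w c) a = c *\<^sub>R weval w a"
  "peval (p + q) a = peval p a + peval q a"
  using setsum_keys_plus_distrib[of "\<lambda>w c. c *\<^sub>R weval w a" p q]
  by (simp_all add: peval_def scaleR_add_left)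

lemma riesz_simps [simp]:
  "riesz y 0 = 0" "riesz y (Poly_Mapping.single w c) = c * y w"
  "riesz y (p + q) = riesz y p + riesz y q"
  using setsum_keys_plus_distrib[of "\<lambda>w c. c * y w" p q]
  by (simp_all add: riesz_def distrib_right)

lemma pstar_simps [simp]:
  "pstar 0 = 0" "pstar (Poly_Mapping.single w c) = Poly_Mapping.single (wstar w) c"
  "pstar (p + q) = pstar p + pstar q"
  using setsum_keys_plus_distrib[of "\<lambda>w c. Poly_Mapping.single (wstar w) c" p q]
  by (simp_all add: pstar_def single_add)

lemma pstar_pstar [simp]: "pstar (pstar p) = p"
  by (induction p rule: poly_mapping_single_induct) simp_all

lemma peval_pstar [simp]: "peval (pstar p) a = qcnj (peval p a)"
  by (induction p rule: poly_mapping_single_induct) simp_all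

lemma riesz_pstar:
  assumes "pseudo_moment y"
  shows "riesz y (pstar p) = riesz y p"
proof (induction p rule: poly_mapping_single_induct)
  case (single w c)
  have "y (wstar w) = y w" using assms unfolding pseudo_moment_def by metis
  then show ?case by simp
qed simp_all

lemma peval_mult [simp]: "peval (p * q) a = peval p a * peval q a"
proof (induction p rule: poly_mapping_single_induct)
  case (single w c)
  show ?case
    by (induction q rule: poly_mapping_single_induct) (simp_all add: mult_single distrib_left)
qed (simp_all add: distrib_right)

lemma peval_one [simp]: "peval 1 a = 1"
  using peval_simps(2)[of 0 1] by simp

lemma peval_sum: "peval (\<Sum>i\<in>I. f i) a = (\<Sum>i\<in>I. peval (f i) a)"
  by (induction I rule: infinite_finite_induct) simp_all

text \<open>The empty word is the additive \<open>0\<close>, so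
  \<open>Poly_Mapping.single 0 c\<close> is the constant c and multiplying by it is scalar
  multiplication.\<close>

lemma riesz_scale [simp]: "riesz y (Poly_Mapping.single 0 c * p) = c * riesz y p"
  by (induction p rule: poly_mapping_single_induct) (simp_all add: mult_single distrib_left)

lemma pstar_scale [simp]: "pstar (Poly_Mapping.single 0 c * p) = Poly_Mapping.single 0 c * pstar p"
  by (induction p rule: poly_mapping_single_induct) (simp_all add: mult_single distrib_left)

lemma continuous_peval: "continuous_on S (peval p)"
  unfolding peval_def[abs_def] by (intro continuous_intros continuous_weval)

lemma quat_in_Reals_iff: "q \<in> \<real> \<longleftrightarrow> qIm1 q = 0 \<and> qIm2 q = 0 \<and> qIm3 q = 0"
proof
  show "q \<in> \<real>" if "qIm1 q = 0 \<and> qIm2 q = 0 \<and> qIm3 q = 0"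
  proof -
    have "q = of_real (qRe q)" using that by (simp add: quat_eq_iff of_real_def)
    then show ?thesis by (metis Reals_of_real)
  qed
qed (auto simp: of_real_def elim!: Reals_cases)

text \<open>For a quaternion, being real and nonnegative amounts to three equations and one
  inequality in its continuous coordinates, so the set is an intersection of closed sets.\<close>

lemma closed_K_set:
  fixes g h :: "nat \<Rightarrow> 'n::finite qpoly"
  shows "closed (K_set m g l h)"
proof -
  have "continuous_on UNIV (\<lambda>a. F (peval p a))" if "continuous_on UNIV F"
    for F :: "quat \<Rightarrow> real" and p :: "'n::finite qpoly"
    using that continuous_peval by (rule continuous_on_compose2) simp
  note c = this[OF continuous_qRe(1)] this[OF continuous_qRe(2)]
    this[OF continuous_qRe(3)] this[OF continuous_qRe(4)]
  show ?thesis
    unfolding K_set_def qnonneg_def quat_in_Reals_iff Collect_conj_eq Ball_def imp_conv_disj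
    by (intro closed_Int closed_Collect_all closed_Collect_disj closed_Collect_conj closed_Collect_const
        closed_Collect_le closed_Collect_eq continuous_on_const c continuous_peval)
qed

text \<open>The words \<open>[Q i, Qbar i]\<close> sum to |a|^2 and \<open>p * pstar p\<close>
  evaluates to |p(a)|^2, so the value at a is the real number (2 + |a|^2)(1 + |p(a)|^2). This
  supplies the growth condition of \<open>haviland\<close>.\<close>

definition dominating_poly :: "'n::finite qpoly \<Rightarrow> 'n qpoly" where
  "dominating_poly p =
    (2 + (\<Sum>i\<in>UNIV. Poly_Mapping.single (abs_word [Q i, Qbar i]) 1)) * (1 + p * pstar p)"

lemma dominating_poly: "(1 + norm a) * \<bar>qRe (peval p a)\<bar> \<le> qRe (peval (dominating_poly p) a)"
proof -
  have "weval (abs_word [Q i, Qbar i]) a = (norm (a $ i))\<^sup>2 *\<^sub>R 1" for i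
    by (simp add: weval.abs_eq letter_eval_def quat_mult_qcnj)
  then have "(\<Sum>i\<in>UNIV. weval (abs_word [Q i, Qbar i]) a) = (norm a)\<^sup>2 *\<^sub>R 1"
    by (simp add: norm_vec_def L2_set_def sum_nonneg scaleR_sum_left)
  moreover have "peval 2 a = 2 *\<^sub>R 1"
    using peval_simps(2)[of 0 2] by simp
  ultimately have eq: "qRe (peval (dominating_poly p) a) = (2 + (norm a)\<^sup>2) * (1 + (norm (peval p a))\<^sup>2)"
    by (simp add: dominating_poly_def peval_sum quat_mult_qcnj scaleR_add_left[symmetric])
  \<comment> \<open>Applied to |a| and to the absolute real part of p(a), this bounds the two
    factors separately.\<close>
  have sq: "t \<le> 1 + t\<^sup>2" for t :: real
    using zero_le_power2[of "t - 1/2"] by (simp add: power2_eq_square algebra_simps)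
  have "(qRe (peval p a))\<^sup>2 \<le> (norm (peval p a))\<^sup>2"
    by (simp add: norm_quat_squared)
  then have "\<bar>qRe (peval p a)\<bar> \<le> 1 + (norm (peval p a))\<^sup>2"
    using sq[of "\<bar>qRe (peval p a)\<bar>"] by simp
  then show ?thesis
    unfolding eq using sq[of "norm a"] by (intro mult_mono) auto
qed

text \<open>Evaluation respects sums, products and the involution, so the polynomials vanishing at
  \<open>a\<close> are closed under every rule of \<open>star_ideal\<close>.\<close>

lemma star_ideal_vanishes:
  assumes "p \<in> star_ideal H" and "\<And>h. h \<in> H \<Longrightarrow> peval h a = 0"
  shows "peval p a = 0"
  using assms by induction auto

lemma represents_riesz:
  assumes "represents \<mu> y"
  shows "integrable \<mu> (\<lambda>a. qRe (peval p a)) \<and> riesz y p = (\<integral>a. qRe (peval p a) \<partial>\<mu>)"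
proof (induction p rule: poly_mapping_single_induct)
  case (single w c)
  then show ?case using assms by (auto simp: represents_def)
qed auto

section \<open>The quaternionic moment problem\<close>

theorem theorem5p3:
  fixes m l :: nat
    and g h :: "nat \<Rightarrow> 'n::finite qpoly"
    and y :: "'n word \<Rightarrow> real"
  assumes "\<forall>i\<in>{1..m}. g i \<in> Sym"
    and "pseudo_moment y"
  shows "((\<exists>\<mu>. represents \<mu> y \<and> supported_on \<mu> (K_set m g l h)) \<longleftrightarrow>
          (\<forall>f\<in>Sym. (\<forall>a\<in>K_set m g l h. qnonneg (peval f a)) \<longrightarrow> 0 \<le> riesz y f)) \<and>
         ((\<exists>\<mu>. represents \<mu> y \<and> supported_on \<mu> (K_set m g l h)) \<longrightarrow>
          (\<forall>p\<in>vanishing_ideal. \<forall>q\<in>star_ideal (h ` {1..l}). riesz y (p + q) = 0))"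
proof (intro conjI iffI impI ballI)
  let ?K = "K_set m g l h"
  fix f :: "'n qpoly" assume "\<exists>\<mu>. represents \<mu> y \<and> supported_on \<mu> ?K" and f: "\<forall>a\<in>?K. qnonneg (peval f a)"
  then obtain \<mu> where \<mu>: "represents \<mu> y" "AE a in \<mu>. a \<in> ?K"
    by (auto simp: supported_on_def)
  have "AE a in \<mu>. 0 \<le> qRe (peval f a)"
    using \<mu>(2) by eventually_elim (use f in \<open>simp add: qnonneg_def\<close>)
  then show "0 \<le> riesz y f"
    using represents_riesz[OF \<mu>(1), of f] by (simp add: integral_nonneg_AE)
next
  let ?K = "K_set m g l h"
  fix p q :: "'n qpoly" assume p: "p \<in> vanishing_ideal" and q: "q \<in> star_ideal (h ` {1..l})"
    and ex: "\<exists>\<mu>. represents \<mu> y \<and> supported_on \<mu> ?K"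
  from ex obtain \<mu> where \<mu>: "represents \<mu> y" "AE a in \<mu>. a \<in> ?K"
    by (auto simp: supported_on_def)
  \<comment> \<open>\<open>p\<close> vanishes everywhere and \<open>q\<close> on \<open>?K\<close>,
    where \<open>\<mu>\<close> is concentrated.\<close>
  have "qRe (peval (p + q) a) = 0" if "a \<in> ?K" for a
  proof -
    have "peval q a = 0"
      using q by (rule star_ideal_vanishes) (use that in \<open>auto simp: K_set_def\<close>)
    then show ?thesis using p by (simp add: vanishing_ideal_def)
  qed
  then have "AE a in \<mu>. qRe (peval (p + q) a) = 0"
    by (rule AE_mp[OF \<mu>(2) AE_I2, OF impI])
  then show "riesz y (p + q) = 0"
    using represents_riesz[OF \<mu>(1), of "p + q"] integral_eq_zero_AE[of "\<lambda>a. qRe (peval (p + q) a)" \<mu>]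
    by simp
next
  let ?K = "K_set m g l h"
  assume pos: "\<forall>f\<in>Sym. (\<forall>a\<in>?K. qnonneg (peval f a)) \<longrightarrow> 0 \<le> riesz y f"
  \<comment> \<open>Representing measures see only real parts of values; \<open>range ev\<close> is
    the function space to which \<open>haviland\<close> is applied.\<close>
  define ev where "ev p = (\<lambda>a. qRe (peval p a))" for p :: "'n qpoly"
  have ev_add: "ev (p + q) = ev p + ev q" and ev_scale: "ev (Poly_Mapping.single 0 c * p) = c *\<^sub>R ev p"
    for p q :: "'n qpoly" and c by (simp_all add: ev_def fun_eq_iff)
  have ev_pos: "0 \<le> riesz y p" if p: "\<And>a. a \<in> ?K \<Longrightarrow> 0 \<le> ev p a" for p
  proof -
    \<comment> \<open>The symmetric part of \<open>p\<close> is real-valued with values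
      \<open>ev p\<close>, and it has the same \<open>riesz y\<close> because \<open>y\<close> is
      invariant under the involution. Positivity thus passes from \<open>Sym\<close> to all
      polynomials.\<close>
    define f where "f = Poly_Mapping.single 0 (1/2) * (p + pstar p)"
    have "f \<in> Sym" by (simp add: f_def Sym_def add.commute)
    moreover have "qnonneg (peval f a)" if "a \<in> ?K" for a
      using p[OF that] by (simp add: f_def ev_def qnonneg_def quat_in_Reals_iff)
    ultimately have "0 \<le> riesz y f" using pos by blast
    then show ?thesis by (simp add: f_def riesz_pstar[OF assms(2)])
  qed
  \<comment> \<open>Both p - q and q - p have zero real part everywhere, hence nonnegative
    \<open>riesz y\<close>. This makes \<open>L\<close> below independent of the chosen
    representative.\<close>
  have ev_eq: "riesz y p = riesz y q" if "ev p = ev q" for p q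
    using ev_pos[of "p + Poly_Mapping.single 0 (- 1) * q"] ev_pos[of "q + Poly_Mapping.single 0 (- 1) * p"] that
    by (simp add: ev_add ev_scale)
  define L where "L f = riesz y (SOME p. ev p = f)" for f
  have L: "L (ev p) = riesz y p" for p
    unfolding L_def by (rule ev_eq) (rule someI, rule refl)
  obtain \<mu> where \<mu>: "sets \<mu> = sets borel" "AE a in \<mu>. a \<in> ?K"
    and int: "\<And>f. f \<in> range ev \<Longrightarrow> integrable \<mu> f \<and> integral\<^sup>L \<mu> f = L f"
  proof (rule haviland[of "range ev" L ?K])
    show "subspace (range ev)"
    proof (rule subspaceI)
      have "ev 0 = 0" by (simp add: ev_def fun_eq_iff)
      then show "0 \<in> range ev" by (metis rangeI)
      show "f + f' \<in> range ev" if "f \<in> range ev" "f' \<in> range ev" for f f'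
        using that by (auto simp: ev_add[symmetric])
      show "c *\<^sub>R f \<in> range ev" if "f \<in> range ev" for c f
        using that by (auto simp: ev_scale[symmetric])
    qed
    have "ev 1 = (\<lambda>_. 1)" by (simp add: ev_def)
    then show "(\<lambda>_. 1) \<in> range ev" by (metis rangeI)
  next
    fix f assume "f \<in> range ev"
    then obtain p where p: "f = ev p" by blast
    show "continuous_on UNIV f"
      unfolding p ev_def by (rule continuous_on_compose2[OF continuous_qRe(1)[of UNIV] continuous_peval]) simp
    show "\<exists>g\<in>range ev. \<forall>x. (1 + norm x) * \<bar>f x\<bar> \<le> g x"
      using dominating_poly[of _ p] by (intro bexI[of _ "ev (dominating_poly p)"]) (auto simp: p ev_def)
    show "L (c *\<^sub>R f) = c * L f" for c
      by (simp add: p ev_scale[symmetric] L)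
    show "0 \<le> L f" if "\<And>x. x \<in> ?K \<Longrightarrow> 0 \<le> f x"
      using that by (simp add: p L ev_pos)
    show "L (f + f') = L f + L f'" if "f' \<in> range ev" for f'
      using that by (auto simp: p ev_add[symmetric] L)
  qed (use closed_K_set in blast)+
  have "represents \<mu> y"
    unfolding represents_def
  proof (intro conjI allI)
    fix w
    have "ev (Poly_Mapping.single w 1) = (\<lambda>a. qRe (weval w a))" by (simp add: ev_def)
    then show "integrable \<mu> (\<lambda>a. qRe (weval w a))" "y w = (\<integral>a. qRe (weval w a) \<partial>\<mu>)"
      using int[OF rangeI, of "Poly_Mapping.single w 1"] L[of "Poly_Mapping.single w 1"] by auto
  qed (rule \<mu>)
  with \<mu>(2) show "\<exists>\<mu>. represents \<mu> y \<and> supported_on \<mu> ?K"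
    by (auto simp: supported_on_def)
qed

end
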